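(* Let $\pi\colon E\to I$ be a fibred site satisfying (i)--(iii) of the context, $I'$ a $\mathbb U$-site in which fibre products are representable, $\varphi\colon I'\to I$ a continuous functor which commutes with fibre products, $\pi'\colon E'\to I'$ the base change of $\pi$ by $\varphi$, and $\Phi\colon E'\to E$ the canonical projection. Equip $E$ and $E'$ with the co-evanescent topologies associated with $\pi$ and $\pi'$. Suppose that: (i) the category $I'$ is $\mathbb U$-small and the functor $\varphi$ is fully faithful; (ii) the topology of $I'$ is induced by that of $I$ via $\varphi$; (iii) every object of $I$ can be covered by objects coming from $I'$ (i.e. of the form $\varphi(i')$); and that moreover, for every $i'\in\mathrm{Ob}(I')$, the category $E'_{i'}$ is $\mathbb U$-small. Then the co-evanescent topology of $E'$ is induced by that of $E$ via the functor $\Phi$.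
   Context: Fix a universe $\mathbb U$ containing an element of infinite cardinality; sheaves are of $\mathbb U$-sets. Let $I$ be a $\mathbb U$-site and $\pi\colon E\to I$ a cleaved and normalized fibred category over the category underlying $I$, such that: (i) fibre products are representable in $I$; (ii) for every $i\in\mathrm{Ob}(I)$, the fibre category $E_i$ is equipped with a topology making it a $\mathbb U$-site, and finite limits are representable in $E_i$; (iii) for every morphism $f\colon i\to j$ of $I$, the inverse image functor $f^+\colon E_j\to E_i$ is continuous and left exact. The co-evanescent topology on $E$ is the topology generated by the families $(V_n\to V)_{n\in\Sigma}$ of the following two types: (v) there is $i\in \mathrm{Ob}(I)$ such that $(V_n\to V)_{n\in\Sigma}$ is a covering family of $E_i$; (c) there is a covering family $(f_n\colon i_n\to i)_{n\in\Sigma}$ of $I$, with $i=\pi(V)$, such that $V_n$ is isomorphic to $f_n^+(V)$ for all $n$ (with $V_n\to V$ the canonical morphism). The base change $\pi'\colon E'\to I'$ has fibre $E'_{i'}=E_{\varphi(i')}$ over $i'\in\mathrm{Ob}(I')$, with the same topology, and satisfies the analogues of (i)--(iii); $E'$ is given the co-evanescent topology associated with $\pi'$. Given a functor $u\colon C'\to C$ into a site $C$, the topology on $C'$ induced by that of $C$ via $u$ is the finest topology on $C'$ for which $u$ is continuous (i.e. such that $F\circ u$ is a sheaf for every sheaf $F$ on $C$). *)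

theory Defs
  imports Main
begin

section \<open>Universes\<close>

text \<open>A Grothendieck universe in the sense of SGA 4, presented by the type \<open>'u\<close> of its elements
  and the map \<open>el\<close> sending an element to the set of its elements (so transitivity is built into the
  type of \<open>el\<close>).  The closure under subsets is the part of \<open>P(x) \<in> U\<close> that is due to transitivity.
  The last clause asks for an element of infinite cardinality.\<close>

definition universe :: "('u \<Rightarrow> 'u set) \<Rightarrow> bool" where
  "universe el \<longleftrightarrow>
     inj el \<and>
     (\<forall>x y. \<exists>z. el z = {x, y}) \<and>
     (\<forall>x A. A \<subseteq> el x \<longrightarrow> (\<exists>z. el z = A)) \<and>
     (\<forall>x. \<exists>z. el z = {y. el y \<subseteq> el x}) \<and>
     (\<forall>x f. \<exists>z. el z = (\<Union>i\<in>el x. el (f i))) \<and>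
     (\<exists>x. infinite (el x))"

definition small :: "('u \<Rightarrow> 'u set) \<Rightarrow> 'a set \<Rightarrow> bool" where
  "small el A \<longleftrightarrow> (\<exists>x f. bij_betw f A (el x))"


section \<open>Categories and functors\<close>

text \<open>\<open>Comp C g f\<close> is \<open>g\<close> after \<open>f\<close>; it is only meaningful if \<open>Cod C f = Dom C g\<close>.\<close>

record ('o, 'a) cat =
  Obj :: "'o set"
  Arr :: "'a set"
  Dom :: "'a \<Rightarrow> 'o"
  Cod :: "'a \<Rightarrow> 'o"
  Idt :: "'o \<Rightarrow> 'a"
  Comp :: "'a \<Rightarrow> 'a \<Rightarrow> 'a"

definition hom :: "('o, 'a) cat \<Rightarrow> 'o \<Rightarrow> 'o \<Rightarrow> 'a set" where
  "hom C X Y = {f \<in> Arr C. Dom C f = X \<and> Cod C f = Y}"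

definition arrows_to :: "('o, 'a) cat \<Rightarrow> 'o \<Rightarrow> 'a set" where
  "arrows_to C X = {f \<in> Arr C. Cod C f = X}"

definition is_category :: "('o, 'a) cat \<Rightarrow> bool" where
  "is_category C \<longleftrightarrow>
     (\<forall>f\<in>Arr C. Dom C f \<in> Obj C \<and> Cod C f \<in> Obj C) \<and>
     (\<forall>X\<in>Obj C. Idt C X \<in> hom C X X) \<and>
     (\<forall>f\<in>Arr C. \<forall>g\<in>Arr C. Cod C f = Dom C g \<longrightarrow> Comp C g f \<in> hom C (Dom C f) (Cod C g)) \<and>
     (\<forall>f\<in>Arr C. Comp C f (Idt C (Dom C f)) = f \<and> Comp C (Idt C (Cod C f)) f = f) \<and>
     (\<forall>f\<in>Arr C. \<forall>g\<in>Arr C. \<forall>h\<in>Arr C. Cod C f = Dom C g \<longrightarrow> Cod C g = Dom C h \<longrightarrow>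
        Comp C h (Comp C g f) = Comp C (Comp C h g) f)"

definition is_iso :: "('o, 'a) cat \<Rightarrow> 'a \<Rightarrow> bool" where
  "is_iso C f \<longleftrightarrow> f \<in> Arr C \<and>
     (\<exists>g \<in> hom C (Cod C f) (Dom C f).
        Comp C g f = Idt C (Dom C f) \<and> Comp C f g = Idt C (Cod C f))"

definition locally_small :: "('u \<Rightarrow> 'u set) \<Rightarrow> ('o, 'a) cat \<Rightarrow> bool" where
  "locally_small el C \<longleftrightarrow> (\<forall>X\<in>Obj C. \<forall>Y\<in>Obj C. small el (hom C X Y))"

definition small_category :: "('u \<Rightarrow> 'u set) \<Rightarrow> ('o, 'a) cat \<Rightarrow> bool" where
  "small_category el C \<longleftrightarrow> small el (Obj C) \<and> small el (Arr C)"

record ('o, 'a, 'p, 'b) ftr =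
  on_obj :: "'o \<Rightarrow> 'p"
  on_arr :: "'a \<Rightarrow> 'b"

definition is_functor :: "('o, 'a) cat \<Rightarrow> ('p, 'b) cat \<Rightarrow> ('o, 'a, 'p, 'b) ftr \<Rightarrow> bool" where
  "is_functor C D u \<longleftrightarrow>
     (\<forall>X\<in>Obj C. on_obj u X \<in> Obj D \<and> on_arr u (Idt C X) = Idt D (on_obj u X)) \<and>
     (\<forall>f\<in>Arr C. on_arr u f \<in> hom D (on_obj u (Dom C f)) (on_obj u (Cod C f))) \<and>
     (\<forall>f\<in>Arr C. \<forall>g\<in>Arr C. Cod C f = Dom C g \<longrightarrow>
        on_arr u (Comp C g f) = Comp D (on_arr u g) (on_arr u f))"

definition fully_faithful ::
  "('o, 'a) cat \<Rightarrow> ('p, 'b) cat \<Rightarrow> ('o, 'a, 'p, 'b) ftr \<Rightarrow> bool" where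
  "fully_faithful C D u \<longleftrightarrow>
     (\<forall>X\<in>Obj C. \<forall>Y\<in>Obj C. bij_betw (on_arr u) (hom C X Y) (hom D (on_obj u X) (on_obj u Y)))"

definition ftr_comp ::
  "('p, 'b, 'q, 'c) ftr \<Rightarrow> ('o, 'a, 'p, 'b) ftr \<Rightarrow> ('o, 'a, 'q, 'c) ftr" where
  "ftr_comp v u = \<lparr>on_obj = on_obj v \<circ> on_obj u, on_arr = on_arr v \<circ> on_arr u\<rparr>"


section \<open>Limits\<close>

definition is_pullback :: "('o, 'a) cat \<Rightarrow> 'a \<Rightarrow> 'a \<Rightarrow> 'a \<Rightarrow> 'a \<Rightarrow> bool" where
  "is_pullback C f g p q \<longleftrightarrow>
     f \<in> Arr C \<and> g \<in> Arr C \<and> p \<in> Arr C \<and> q \<in> Arr C \<and>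
     Cod C f = Cod C g \<and> Dom C p = Dom C q \<and> Cod C p = Dom C f \<and> Cod C q = Dom C g \<and>
     Comp C f p = Comp C g q \<and>
     (\<forall>a\<in>Arr C. \<forall>b\<in>Arr C.
        Dom C a = Dom C b \<longrightarrow> Cod C a = Dom C f \<longrightarrow> Cod C b = Dom C g \<longrightarrow>
        Comp C f a = Comp C g b \<longrightarrow>
        (\<exists>!h. h \<in> hom C (Dom C a) (Dom C p) \<and> Comp C p h = a \<and> Comp C q h = b))"

definition has_fibre_products :: "('o, 'a) cat \<Rightarrow> bool" where
  "has_fibre_products C \<longleftrightarrow>
     (\<forall>f\<in>Arr C. \<forall>g\<in>Arr C. Cod C f = Cod C g \<longrightarrow> (\<exists>p q. is_pullback C f g p q))"

definition preserves_fibre_products ::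
  "('o, 'a) cat \<Rightarrow> ('p, 'b) cat \<Rightarrow> ('o, 'a, 'p, 'b) ftr \<Rightarrow> bool" where
  "preserves_fibre_products C D u \<longleftrightarrow>
     (\<forall>f g p q. is_pullback C f g p q \<longrightarrow>
        is_pullback D (on_arr u f) (on_arr u g) (on_arr u p) (on_arr u q))"

definition is_cone ::
  "('k, 'l) cat \<Rightarrow> ('o, 'a) cat \<Rightarrow> ('k, 'l, 'o, 'a) ftr \<Rightarrow> 'o \<Rightarrow> ('k \<Rightarrow> 'a) \<Rightarrow> bool" where
  "is_cone K C G L leg \<longleftrightarrow>
     L \<in> Obj C \<and>
     (\<forall>k\<in>Obj K. leg k \<in> hom C L (on_obj G k)) \<and>
     (\<forall>e\<in>Arr K. Comp C (on_arr G e) (leg (Dom K e)) = leg (Cod K e))"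

definition is_limit ::
  "('k, 'l) cat \<Rightarrow> ('o, 'a) cat \<Rightarrow> ('k, 'l, 'o, 'a) ftr \<Rightarrow> 'o \<Rightarrow> ('k \<Rightarrow> 'a) \<Rightarrow> bool" where
  "is_limit K C G L leg \<longleftrightarrow>
     is_cone K C G L leg \<and>
     (\<forall>M leg'. is_cone K C G M leg' \<longrightarrow>
        (\<exists>!h. h \<in> hom C M L \<and> (\<forall>k\<in>Obj K. Comp C (leg k) h = leg' k)))"

text \<open>Every finite category is isomorphic to one whose objects and arrows are natural numbers, so it
  is no restriction to use only these as index categories of finite limits.\<close>

definition finite_category :: "(nat, nat) cat \<Rightarrow> bool" where
  "finite_category K \<longleftrightarrow> is_category K \<and> finite (Obj K) \<and> finite (Arr K)"

definition has_finite_limits :: "('o, 'a) cat \<Rightarrow> bool" where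
  "has_finite_limits C \<longleftrightarrow>
     (\<forall>K G. finite_category K \<longrightarrow> is_functor K C G \<longrightarrow> (\<exists>L leg. is_limit K C G L leg))"

definition left_exact ::
  "('o, 'a) cat \<Rightarrow> ('p, 'b) cat \<Rightarrow> ('o, 'a, 'p, 'b) ftr \<Rightarrow> bool" where
  "left_exact C D u \<longleftrightarrow>
     is_functor C D u \<and>
     (\<forall>K G L leg. finite_category K \<longrightarrow> is_functor K C G \<longrightarrow> is_limit K C G L leg \<longrightarrow>
        is_limit K D (ftr_comp u G) (on_obj u L) (on_arr u \<circ> leg))"


section \<open>Sites and sheaves\<close>

definition is_sieve :: "('o, 'a) cat \<Rightarrow> 'o \<Rightarrow> 'a set \<Rightarrow> bool" where
  "is_sieve C X S \<longleftrightarrow>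
     S \<subseteq> arrows_to C X \<and> (\<forall>f\<in>S. \<forall>g\<in>arrows_to C (Dom C f). Comp C f g \<in> S)"

definition pull_sieve :: "('o, 'a) cat \<Rightarrow> 'a \<Rightarrow> 'a set \<Rightarrow> 'a set" where
  "pull_sieve C f S = {g \<in> arrows_to C (Dom C f). Comp C f g \<in> S}"

definition sieve_generated :: "('o, 'a) cat \<Rightarrow> 'a set \<Rightarrow> 'a set" where
  "sieve_generated C R = {Comp C f g |f g. f \<in> R \<and> g \<in> arrows_to C (Dom C f)}"

text \<open>\<open>J X\<close> is the set of covering sieves of \<open>X\<close>; its value is irrelevant if \<open>X\<close> is not an object.\<close>

type_synonym ('o, 'a) topol = "'o \<Rightarrow> 'a set set"

definition is_topology :: "('o, 'a) cat \<Rightarrow> ('o, 'a) topol \<Rightarrow> bool" where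
  "is_topology C J \<longleftrightarrow>
     (\<forall>X\<in>Obj C.
        (\<forall>S\<in>J X. is_sieve C X S) \<and>
        arrows_to C X \<in> J X \<and>
        (\<forall>S\<in>J X. \<forall>f\<in>arrows_to C X. pull_sieve C f S \<in> J (Dom C f)) \<and>
        (\<forall>S\<in>J X. \<forall>R. is_sieve C X R \<longrightarrow>
           (\<forall>f\<in>S. pull_sieve C f R \<in> J (Dom C f)) \<longrightarrow> R \<in> J X))"

text \<open>A family of arrows with target \<open>X\<close> is given by the set of its members: whether it is covering
  depends only on the sieve it generates, hence not on repetitions.\<close>

definition covering_family :: "('o, 'a) cat \<Rightarrow> ('o, 'a) topol \<Rightarrow> 'o \<Rightarrow> 'a set \<Rightarrow> bool" where
  "covering_family C J X R \<longleftrightarrow> R \<subseteq> arrows_to C X \<and> sieve_generated C R \<in> J X"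

text \<open>The coarsest topology for which all families in \<open>G\<close> are covering.\<close>

definition generated_topology ::
  "('o, 'a) cat \<Rightarrow> ('o \<Rightarrow> 'a set \<Rightarrow> bool) \<Rightarrow> ('o, 'a) topol" where
  "generated_topology C G X =
     {S. \<forall>J. is_topology C J \<longrightarrow>
           (\<forall>Y\<in>Obj C. \<forall>R. G Y R \<longrightarrow> covering_family C J Y R) \<longrightarrow> S \<in> J X}"

definition U_site :: "('u \<Rightarrow> 'u set) \<Rightarrow> ('o, 'a) cat \<Rightarrow> ('o, 'a) topol \<Rightarrow> bool" where
  "U_site el C J \<longleftrightarrow>
     is_category C \<and> locally_small el C \<and> is_topology C J \<and>
     (\<exists>G \<subseteq> Obj C. small el G \<and>
        (\<forall>X\<in>Obj C. \<exists>R. covering_family C J X R \<and> (\<forall>f\<in>R. Dom C f \<in> G)))"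

text \<open>A presheaf of sets in the universe: \<open>section_set F X\<close> is an element of the universe, and
  \<open>restrict_along F f\<close> is only meaningful on \<open>el (section_set F (Cod C f))\<close>.\<close>

record ('o, 'a, 'u) presheaf =
  section_set :: "'o \<Rightarrow> 'u"
  restrict_along :: "'a \<Rightarrow> 'u \<Rightarrow> 'u"

definition is_presheaf ::
  "('u \<Rightarrow> 'u set) \<Rightarrow> ('o, 'a) cat \<Rightarrow> ('o, 'a, 'u) presheaf \<Rightarrow> bool" where
  "is_presheaf el C F \<longleftrightarrow>
     (\<forall>f\<in>Arr C. \<forall>s\<in>el (section_set F (Cod C f)).
        restrict_along F f s \<in> el (section_set F (Dom C f))) \<and>
     (\<forall>X\<in>Obj C. \<forall>s\<in>el (section_set F X). restrict_along F (Idt C X) s = s) \<and>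
     (\<forall>f\<in>Arr C. \<forall>g\<in>Arr C. Cod C f = Dom C g \<longrightarrow> (\<forall>s\<in>el (section_set F (Cod C g)).
        restrict_along F (Comp C g f) s = restrict_along F f (restrict_along F g s)))"

text \<open>A morphism from a sieve (as a subpresheaf of the presheaf represented by its target) to \<open>F\<close>.\<close>

definition matching_family ::
  "('u \<Rightarrow> 'u set) \<Rightarrow> ('o, 'a) cat \<Rightarrow> ('o, 'a, 'u) presheaf \<Rightarrow> 'a set \<Rightarrow> ('a \<Rightarrow> 'u) \<Rightarrow> bool" where
  "matching_family el C F S t \<longleftrightarrow>
     (\<forall>f\<in>S. t f \<in> el (section_set F (Dom C f)) \<and>
        (\<forall>g\<in>arrows_to C (Dom C f). t (Comp C f g) = restrict_along F g (t f)))"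

definition is_sheaf ::
  "('u \<Rightarrow> 'u set) \<Rightarrow> ('o, 'a) cat \<Rightarrow> ('o, 'a) topol \<Rightarrow> ('o, 'a, 'u) presheaf \<Rightarrow> bool" where
  "is_sheaf el C J F \<longleftrightarrow>
     is_presheaf el C F \<and>
     (\<forall>X\<in>Obj C. \<forall>S\<in>J X. \<forall>t. matching_family el C F S t \<longrightarrow>
        (\<exists>!s. s \<in> el (section_set F X) \<and> (\<forall>f\<in>S. restrict_along F f s = t f)))"

definition presheaf_comp ::
  "('p, 'b, 'u) presheaf \<Rightarrow> ('o, 'a, 'p, 'b) ftr \<Rightarrow> ('o, 'a, 'u) presheaf" where
  "presheaf_comp F u =
     \<lparr>section_set = section_set F \<circ> on_obj u, restrict_along = restrict_along F \<circ> on_arr u\<rparr>"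

text \<open>\<open>continuous_functor el C' J' C J u\<close>: the functor \<open>u\<close> from the site \<open>(C', J')\<close> to the site
  \<open>(C, J)\<close> is continuous, in the sense of SGA 4.\<close>

definition continuous_functor ::
  "('u \<Rightarrow> 'u set) \<Rightarrow> ('o, 'a) cat \<Rightarrow> ('o, 'a) topol \<Rightarrow> ('p, 'b) cat \<Rightarrow> ('p, 'b) topol \<Rightarrow>
   ('o, 'a, 'p, 'b) ftr \<Rightarrow> bool" where
  "continuous_functor el C' J' C J u \<longleftrightarrow>
     is_functor C' C u \<and>
     (\<forall>F. is_sheaf el C J F \<longrightarrow> is_sheaf el C' J' (presheaf_comp F u))"

text \<open>\<open>J'\<close> is the topology on \<open>C'\<close> induced by \<open>J\<close> via \<open>u\<close>.\<close>

definition is_induced_topology ::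
  "('u \<Rightarrow> 'u set) \<Rightarrow> ('o, 'a) cat \<Rightarrow> ('o, 'a) topol \<Rightarrow> ('p, 'b) cat \<Rightarrow> ('p, 'b) topol \<Rightarrow>
   ('o, 'a, 'p, 'b) ftr \<Rightarrow> bool" where
  "is_induced_topology el C' J' C J u \<longleftrightarrow>
     is_topology C' J' \<and>
     continuous_functor el C' J' C J u \<and>
     (\<forall>J''. is_topology C' J'' \<longrightarrow> continuous_functor el C' J'' C J u \<longrightarrow>
        (\<forall>X\<in>Obj C'. J'' X \<subseteq> J' X))"


section \<open>Cleaved fibred categories and fibred sites\<close>

text \<open>\<open>cleavage S f V\<close> is the canonical arrow \<open>f\<^sup>+(V) \<rightarrow> V\<close> over \<open>f\<close>, for \<open>V\<close> in the fibre
  over the target of \<open>f\<close>, and \<open>fib_top S i\<close> is the topology of the fibre over \<open>i\<close>.\<close>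

record ('i, 'a, 'e, 'm) fsite =
  base :: "('i, 'a) cat"
  base_top :: "('i, 'a) topol"
  total_cat :: "('e, 'm) cat"
  proj :: "('e, 'm, 'i, 'a) ftr"
  cleavage :: "'a \<Rightarrow> 'e \<Rightarrow> 'm"
  fib_top :: "'i \<Rightarrow> ('e, 'm) topol"

definition fibre :: "('i, 'a, 'e, 'm) fsite \<Rightarrow> 'i \<Rightarrow> ('e, 'm) cat" where
  "fibre S i = (total_cat S)
     \<lparr>Obj := {V \<in> Obj (total_cat S). on_obj (proj S) V = i},
      Arr := {m \<in> Arr (total_cat S). on_obj (proj S) (Dom (total_cat S) m) = i \<and>
                on_obj (proj S) (Cod (total_cat S) m) = i \<and> on_arr (proj S) m = Idt (base S) i}\<rparr>"

text \<open>Cartesian arrows and fibred categories are taken in the sense of SGA 1, VI.\<close>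

definition is_cartesian :: "('i, 'a, 'e, 'm) fsite \<Rightarrow> 'm \<Rightarrow> bool" where
  "is_cartesian S m \<longleftrightarrow>
     m \<in> Arr (total_cat S) \<and>
     (\<forall>n\<in>Arr (total_cat S). Cod (total_cat S) n = Cod (total_cat S) m \<longrightarrow>
        on_arr (proj S) n = on_arr (proj S) m \<longrightarrow>
        (\<exists>!h. h \<in> hom (fibre S (on_obj (proj S) (Dom (total_cat S) m)))
                     (Dom (total_cat S) n) (Dom (total_cat S) m) \<and>
              Comp (total_cat S) m h = n))"

definition is_fibred :: "('i, 'a, 'e, 'm) fsite \<Rightarrow> bool" where
  "is_fibred S \<longleftrightarrow>
     is_category (total_cat S) \<and> is_category (base S) \<and>
     is_functor (total_cat S) (base S) (proj S) \<and>
     (\<forall>f\<in>Arr (base S). \<forall>V\<in>Obj (fibre S (Cod (base S) f)).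
        \<exists>m\<in>arrows_to (total_cat S) V. is_cartesian S m \<and> on_arr (proj S) m = f) \<and>
     (\<forall>m n. is_cartesian S m \<longrightarrow> is_cartesian S n \<longrightarrow> Cod (total_cat S) m = Dom (total_cat S) n \<longrightarrow>
        is_cartesian S (Comp (total_cat S) n m))"

definition is_normalized_cleavage :: "('i, 'a, 'e, 'm) fsite \<Rightarrow> bool" where
  "is_normalized_cleavage S \<longleftrightarrow>
     (\<forall>f\<in>Arr (base S). \<forall>V\<in>Obj (fibre S (Cod (base S) f)).
        cleavage S f V \<in> arrows_to (total_cat S) V \<and> is_cartesian S (cleavage S f V) \<and>
        on_arr (proj S) (cleavage S f V) = f) \<and>
     (\<forall>V\<in>Obj (total_cat S). cleavage S (Idt (base S) (on_obj (proj S) V)) V = Idt (total_cat S) V)"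

definition inv_image ::
  "('i, 'a, 'e, 'm) fsite \<Rightarrow> 'a \<Rightarrow> ('e, 'm, 'e, 'm) ftr" where
  "inv_image S f =
     \<lparr>on_obj = (\<lambda>V. Dom (total_cat S) (cleavage S f V)),
      on_arr = (\<lambda>m. THE n.
        n \<in> hom (fibre S (Dom (base S) f))
              (Dom (total_cat S) (cleavage S f (Dom (total_cat S) m)))
              (Dom (total_cat S) (cleavage S f (Cod (total_cat S) m))) \<and>
        Comp (total_cat S) (cleavage S f (Cod (total_cat S) m)) n =
          Comp (total_cat S) m (cleavage S f (Dom (total_cat S) m)))\<rparr>"

definition fibred_site :: "('u \<Rightarrow> 'u set) \<Rightarrow> ('i, 'a, 'e, 'm) fsite \<Rightarrow> bool" where
  "fibred_site el S \<longleftrightarrow>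
     U_site el (base S) (base_top S) \<and>
     is_fibred S \<and> is_normalized_cleavage S \<and>
     has_fibre_products (base S) \<and>
     (\<forall>i\<in>Obj (base S). U_site el (fibre S i) (fib_top S i) \<and> has_finite_limits (fibre S i)) \<and>
     (\<forall>f\<in>Arr (base S).
        continuous_functor el
          (fibre S (Cod (base S) f)) (fib_top S (Cod (base S) f))
          (fibre S (Dom (base S) f)) (fib_top S (Dom (base S) f)) (inv_image S f) \<and>
        left_exact (fibre S (Cod (base S) f)) (fibre S (Dom (base S) f)) (inv_image S f))"

text \<open>The families of type (v), from the fibres, and of type (c), from the base.  In type (c) every
  member of the family is, up to an isomorphism \<open>h\<close> of the fibre, the canonical arrow
  \<open>f\<^sup>+(V) \<rightarrow> V\<close>, where \<open>f\<close> is its image in the base.\<close>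

definition vertical_covering :: "('i, 'a, 'e, 'm) fsite \<Rightarrow> 'e \<Rightarrow> 'm set \<Rightarrow> bool" where
  "vertical_covering S V R \<longleftrightarrow>
     (\<exists>i\<in>Obj (base S). V \<in> Obj (fibre S i) \<and> covering_family (fibre S i) (fib_top S i) V R)"

definition cartesian_covering :: "('i, 'a, 'e, 'm) fsite \<Rightarrow> 'e \<Rightarrow> 'm set \<Rightarrow> bool" where
  "cartesian_covering S V R \<longleftrightarrow>
     V \<in> Obj (total_cat S) \<and> R \<subseteq> arrows_to (total_cat S) V \<and>
     covering_family (base S) (base_top S) (on_obj (proj S) V) (on_arr (proj S) ` R) \<and>
     (\<forall>m\<in>R. \<exists>h. h \<in> hom (fibre S (Dom (base S) (on_arr (proj S) m)))
                         (Dom (total_cat S) m) (on_obj (inv_image S (on_arr (proj S) m)) V) \<and>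
                  is_iso (fibre S (Dom (base S) (on_arr (proj S) m))) h \<and>
                  m = Comp (total_cat S) (cleavage S (on_arr (proj S) m) V) h)"

definition coevanescent_topology :: "('i, 'a, 'e, 'm) fsite \<Rightarrow> ('e, 'm) topol" where
  "coevanescent_topology S =
     generated_topology (total_cat S) (\<lambda>V R. vertical_covering S V R \<or> cartesian_covering S V R)"


section \<open>Base change\<close>

text \<open>The fibre product of categories \<open>I' \<times>\<^bsub>I\<^esub> E\<close> with its projection to \<open>I'\<close>, the cleavage
  and the fibre topologies that it inherits: its fibre over \<open>i'\<close> is identified with the fibre of \<open>E\<close>
  over \<open>\<phi>(i')\<close> by \<open>V \<mapsto> (i', V)\<close> and \<open>m \<mapsto> (id, m)\<close>.\<close>

definition base_change ::
  "('i, 'a, 'e, 'm) fsite \<Rightarrow> ('j, 'b) cat \<Rightarrow> ('j, 'b) topol \<Rightarrow> ('j, 'b, 'i, 'a) ftr \<Rightarrow>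
   ('j, 'b, 'j \<times> 'e, 'b \<times> 'm) fsite" where
  "base_change S I' JI' \<phi> =
     \<lparr>base = I', base_top = JI',
      total_cat =
        \<lparr>Obj = {(i, V). i \<in> Obj I' \<and> V \<in> Obj (total_cat S) \<and> on_obj \<phi> i = on_obj (proj S) V},
         Arr = {(f, m). f \<in> Arr I' \<and> m \<in> Arr (total_cat S) \<and>
                  Dom I' f \<in> Obj I' \<and> on_obj \<phi> (Dom I' f) = on_obj (proj S) (Dom (total_cat S) m) \<and>
                  Cod I' f \<in> Obj I' \<and> on_obj \<phi> (Cod I' f) = on_obj (proj S) (Cod (total_cat S) m) \<and>
                  on_arr \<phi> f = on_arr (proj S) m},
         Dom = (\<lambda>(f, m). (Dom I' f, Dom (total_cat S) m)),
         Cod = (\<lambda>(f, m). (Cod I' f, Cod (total_cat S) m)),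
         Idt = (\<lambda>(i, V). (Idt I' i, Idt (total_cat S) V)),
         Comp = (\<lambda>(g, n) (f, m). (Comp I' g f, Comp (total_cat S) n m))\<rparr>,
      proj = \<lparr>on_obj = fst, on_arr = fst\<rparr>,
      cleavage = (\<lambda>f (i, V). (f, cleavage S (on_arr \<phi> f) V)),
      fib_top = (\<lambda>i (i', V). (\<lambda>R. Pair (Idt I' i) ` R) ` fib_top S (on_obj \<phi> i) V)\<rparr>"

definition base_change_proj :: "('j \<times> 'e, 'b \<times> 'm, 'e, 'm) ftr" where
  "base_change_proj = \<lparr>on_obj = snd, on_arr = snd\<rparr>"

end

theory Submission
  imports Defs
begin

text \<open>Write \<open>\<Phi>\<close> for the projection \<open>E' \<rightarrow> E\<close>.  Since \<open>\<phi>\<close> is fully faithful, so is \<open>\<Phi>\<close>, and every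
  object of \<open>E\<close> is covered by objects coming from \<open>E'\<close> (\<open>proj_dense\<close>): it suffices to pull it back
  along a covering of its projection.  The statement is thus an instance of the comparison lemma of
  topos theory, once both co-evanescent topologies are related through \<open>\<Phi>\<close> in the two following ways.

  The first is that \<open>\<Phi>\<close> sends covering sieves to families that generate covering sieves.  For a dense
  and fully faithful functor, the sieves with this property form a topology (\<open>image_topology\<close>) for
  which the functor is continuous (\<open>image_topology_continuous\<close>).  It thus suffices to check the
  property on the two types of generators, and it is clear for the vertical ones.  For the others, it
  amounts to saying that \<open>\<phi>\<close> preserves covering families, as does every continuous functor
  (\<open>continuous_preserves_covering\<close>).

  The second is that \<open>\<Phi>\<close> is cocontinuous (\<open>proj_cocontinuous\<close>): the arrows of \<open>E'\<close> that a given
  arrow \<open>\<Phi>(X) \<rightarrow> V\<close> sends into a covering sieve of \<open>V\<close> form a covering sieve of \<open>X\<close>.  This is again checked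
  on generators (\<open>vertical_pull\<close> and \<open>cartesian_pull\<close>), by splitting an arrow into a vertical and a
  canonical one.  Here the continuity of the inverse image functors is used, and so is the
  assumption that the topology of \<open>I'\<close> is the induced one.

  The maximality follows.  Let \<open>\<Phi>\<close> be continuous for a topology \<open>J''\<close> on \<open>E'\<close>, and let \<open>R\<close> be a
  sieve of \<open>X\<close> that is covering for \<open>J''\<close>.  Then all sheaves on \<open>E\<close> are separated along the image of
  \<open>R\<close>.  Apply this to the sheaf on \<open>E\<close> that is the direct image of the sheaf of closed sieves of \<open>E'\<close>;
  its sets are small because \<open>E'\<close> is small and \<open>E\<close> has small sets of arrows.  The closure of \<open>R\<close>
  and the maximal sieve are two sections over \<open>\<Phi>(X)\<close> that agree along \<open>R\<close>, so they coincide and \<open>R\<close>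
  is covering (\<open>covering_if_separated\<close>).  The same lemma for an identity functor shows that a topology is
  determined by its sheaves, whence the preservation of covering families by continuous functors.\<close>

section \<open>Categories, sieves and topologies\<close>

locale category =
  fixes C :: "('o, 'a) cat"
  assumes is_category: "is_category C"
begin

lemma Dom_Obj [simp]: "f \<in> Arr C \<Longrightarrow> Dom C f \<in> Obj C"
  and Cod_Obj [simp]: "f \<in> Arr C \<Longrightarrow> Cod C f \<in> Obj C"
  using is_category by (auto simp: is_category_def)

lemma Idt_Arr [simp]: "X \<in> Obj C \<Longrightarrow> Idt C X \<in> Arr C"
  and Dom_Idt [simp]: "X \<in> Obj C \<Longrightarrow> Dom C (Idt C X) = X"
  and Cod_Idt [simp]: "X \<in> Obj C \<Longrightarrow> Cod C (Idt C X) = X"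
  using is_category by (auto simp: is_category_def hom_def)

lemma Comp_Arr [simp]:
    "\<lbrakk>f \<in> Arr C; g \<in> Arr C; Cod C f = Dom C g\<rbrakk> \<Longrightarrow> Comp C g f \<in> Arr C"
  and Dom_Comp [simp]:
    "\<lbrakk>f \<in> Arr C; g \<in> Arr C; Cod C f = Dom C g\<rbrakk> \<Longrightarrow> Dom C (Comp C g f) = Dom C f"
  and Cod_Comp [simp]:
    "\<lbrakk>f \<in> Arr C; g \<in> Arr C; Cod C f = Dom C g\<rbrakk> \<Longrightarrow> Cod C (Comp C g f) = Cod C g"
  using is_category by (auto simp: is_category_def hom_def)

lemma Comp_Idt_right [simp]: "\<lbrakk>f \<in> Arr C; Dom C f = X\<rbrakk> \<Longrightarrow> Comp C f (Idt C X) = f"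
  and Comp_Idt_left [simp]: "\<lbrakk>f \<in> Arr C; Cod C f = Y\<rbrakk> \<Longrightarrow> Comp C (Idt C Y) f = f"
  using is_category by (auto simp: is_category_def)

lemma Comp_assoc [simp]:
  "\<lbrakk>f \<in> Arr C; g \<in> Arr C; h \<in> Arr C; Cod C f = Dom C g; Cod C g = Dom C h\<rbrakk>
     \<Longrightarrow> Comp C (Comp C h g) f = Comp C h (Comp C g f)"
  using is_category by (auto simp: is_category_def)

lemma sieve_generated_is_sieve:
  assumes "R \<subseteq> arrows_to C X"
  shows "is_sieve C X (sieve_generated C R)"
  unfolding is_sieve_def
proof (intro conjI ballI)
  show "sieve_generated C R \<subseteq> arrows_to C X"
    using assms by (auto simp: sieve_generated_def arrows_to_def)
next
  fix f g assume "f \<in> sieve_generated C R" and g: "g \<in> arrows_to C (Dom C f)"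
  then obtain r d where r: "r \<in> R" and d: "d \<in> arrows_to C (Dom C r)" and f: "f = Comp C r d"
    by (auto simp: sieve_generated_def)
  have "Comp C f g = Comp C r (Comp C d g)" and "Comp C d g \<in> arrows_to C (Dom C r)"
    using r d g f assms by (auto simp: arrows_to_def)
  then show "Comp C f g \<in> sieve_generated C R"
    using r by (auto simp: sieve_generated_def)
qed

lemma subset_sieve_generated:
  assumes "R \<subseteq> arrows_to C X"
  shows "R \<subseteq> sieve_generated C R"
proof
  fix f assume f: "f \<in> R"
  have "f = Comp C f (Idt C (Dom C f))" and "Idt C (Dom C f) \<in> arrows_to C (Dom C f)"
    using f assms by (auto simp: arrows_to_def)
  then show "f \<in> sieve_generated C R"
    using f by (auto simp: sieve_generated_def)
qed

lemma sieve_generated_least: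
  assumes "is_sieve C X S" and "R \<subseteq> S"
  shows "sieve_generated C R \<subseteq> S"
  using assms by (auto simp: sieve_generated_def is_sieve_def)

lemma sieve_generated_sieve: "is_sieve C X S \<Longrightarrow> sieve_generated C S = S"
  using sieve_generated_least[of X S S] subset_sieve_generated[of S X] by (auto simp: is_sieve_def)

lemma is_sieve_arrows_to: "is_sieve C X (arrows_to C X)"
  by (auto simp: is_sieve_def arrows_to_def)

lemma is_sieve_pull_sieve:
  assumes "is_sieve C X S" and "f \<in> arrows_to C X"
  shows "is_sieve C (Dom C f) (pull_sieve C f S)"
  unfolding is_sieve_def
proof (intro conjI ballI)
  show "pull_sieve C f S \<subseteq> arrows_to C (Dom C f)"
    by (auto simp: pull_sieve_def)
next
  fix g k assume g: "g \<in> pull_sieve C f S" and k: "k \<in> arrows_to C (Dom C g)"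
  have fa: "f \<in> Arr C" "g \<in> Arr C" "Cod C g = Dom C f" "k \<in> Arr C" "Cod C k = Dom C g"
    and fg: "Comp C f g \<in> S"
    using assms(2) g k by (auto simp: pull_sieve_def arrows_to_def)
  have "Comp C (Comp C f g) k \<in> S"
    using assms(1) fg k fa by (simp add: is_sieve_def del: Comp_assoc)
  then show "Comp C g k \<in> pull_sieve C f S"
    using fa by (simp add: pull_sieve_def arrows_to_def)
qed

end

lemma topologyD:
  assumes "is_topology C J" and "X \<in> Obj C"
  shows topology_sieve: "S \<in> J X \<Longrightarrow> is_sieve C X S"
    and topology_max: "arrows_to C X \<in> J X"
    and topology_pull: "\<lbrakk>S \<in> J X; f \<in> arrows_to C X\<rbrakk> \<Longrightarrow> pull_sieve C f S \<in> J (Dom C f)"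
    and topology_trans: "\<lbrakk>S \<in> J X; is_sieve C X R; \<And>f. f \<in> S \<Longrightarrow> pull_sieve C f R \<in> J (Dom C f)\<rbrakk>
      \<Longrightarrow> R \<in> J X"
proof -
  note X = bspec[OF assms(1)[unfolded is_topology_def] assms(2)]
  show "is_sieve C X S" if "S \<in> J X" by (rule bspec[OF conjunct1[OF X] that])
  note X = conjunct2[OF X]
  show "arrows_to C X \<in> J X" by (rule conjunct1[OF X])
  note X = conjunct2[OF X]
  show "pull_sieve C f S \<in> J (Dom C f)" if "S \<in> J X" "f \<in> arrows_to C X"
    by (rule bspec[OF bspec[OF conjunct1[OF X] that(1)] that(2)])
  note X = conjunct2[OF X]
  show "R \<in> J X"
    if "S \<in> J X" "is_sieve C X R" "\<And>f. f \<in> S \<Longrightarrow> pull_sieve C f R \<in> J (Dom C f)"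
    using bspec[OF X that(1)] that(2,3) by blast
qed

lemma (in category) topology_mono:
  assumes J: "is_topology C J" and X: "X \<in> Obj C" and S: "S \<in> J X"
    and R: "is_sieve C X R" and "S \<subseteq> R"
  shows "R \<in> J X"
proof (rule topology_trans[OF J X S R])
  fix f assume f: "f \<in> S"
  then have fa: "f \<in> arrows_to C X"
    using topology_sieve[OF J X S] by (auto simp: is_sieve_def)
  have "pull_sieve C f R = arrows_to C (Dom C f)"
    using f \<open>S \<subseteq> R\<close> R by (auto simp: pull_sieve_def is_sieve_def)
  then show "pull_sieve C f R \<in> J (Dom C f)"
    using topology_max[OF J] fa by (simp add: arrows_to_def)
qed

lemma (in category) topology_trans_family:
  assumes J: "is_topology C J" and X: "X \<in> Obj C" and R: "covering_family C J X R"
    and Q: "is_sieve C X Q" and pull: "\<And>f. f \<in> R \<Longrightarrow> pull_sieve C f Q \<in> J (Dom C f)"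
  shows "Q \<in> J X"
proof (rule topology_trans[OF J X _ Q])
  show "sieve_generated C R \<in> J X"
    using R by (simp add: covering_family_def)
next
  fix n assume "n \<in> sieve_generated C R"
  then obtain f d where f: "f \<in> R" and d: "d \<in> arrows_to C (Dom C f)" and n: "n = Comp C f d"
    by (auto simp: sieve_generated_def)
  have fa: "f \<in> Arr C" "Cod C f = X" and da: "d \<in> Arr C" "Cod C d = Dom C f"
    using f d R by (auto simp: covering_family_def arrows_to_def)
  have "pull_sieve C n Q = pull_sieve C d (pull_sieve C f Q)"
    using fa da by (auto simp: n pull_sieve_def arrows_to_def)
  then show "pull_sieve C n Q \<in> J (Dom C n)"
    using topology_pull[OF J _ pull[OF f] d] fa da by (simp add: n)
qed

lemma (in category) covering_family_mono:
  assumes J: "is_topology C J" and X: "X \<in> Obj C" and R: "covering_family C J X R"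
    and Q: "is_sieve C X Q" and "R \<subseteq> Q"
  shows "Q \<in> J X"
  using topology_mono[OF J X _ Q sieve_generated_least[OF Q \<open>R \<subseteq> Q\<close>]] R
  by (simp add: covering_family_def)

lemma (in category) covering_sieve:
  assumes J: "is_topology C J" and X: "X \<in> Obj C" and R: "R \<in> J X"
  shows "covering_family C J X R"
  using topology_sieve[OF J X R] R sieve_generated_sieve
  by (auto simp: covering_family_def is_sieve_def)

lemma (in category) generated_topology_is_topology:
  assumes G: "\<And>Y R. \<lbrakk>Y \<in> Obj C; G Y R\<rbrakk> \<Longrightarrow> R \<subseteq> arrows_to C Y"
  shows "is_topology C (generated_topology C G)"
proof -
  let ?adm = "\<lambda>J. is_topology C J \<and> (\<forall>Y\<in>Obj C. \<forall>R. G Y R \<longrightarrow> covering_family C J Y R)"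
  have gen: "S \<in> generated_topology C G X \<longleftrightarrow> (\<forall>J. ?adm J \<longrightarrow> S \<in> J X)" for S X
    by (auto simp: generated_topology_def)
  \<comment> \<open>The topology of all sieves shows that the intersection is not over the empty set.\<close>
  define J0 where "J0 = (\<lambda>X. {S. is_sieve C X S})"
  have "is_topology C J0"
    unfolding is_topology_def J0_def using is_sieve_arrows_to is_sieve_pull_sieve by auto
  then have J0: "?adm J0"
    using G sieve_generated_is_sieve by (auto simp: covering_family_def J0_def)
  show ?thesis
    unfolding is_topology_def
  proof (intro ballI conjI allI impI)
    fix X S assume "X \<in> Obj C" "S \<in> generated_topology C G X"
    then show "is_sieve C X S"
      using J0 by (auto simp: gen J0_def)
  next
    fix X assume "X \<in> Obj C"
    then show "arrows_to C X \<in> generated_topology C G X"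
      by (simp add: gen topology_max)
  next
    fix X S f assume "X \<in> Obj C" "S \<in> generated_topology C G X" "f \<in> arrows_to C X"
    then show "pull_sieve C f S \<in> generated_topology C G (Dom C f)"
      by (simp add: gen topology_pull)
  next
    fix X S R assume *: "X \<in> Obj C" "S \<in> generated_topology C G X" "is_sieve C X R"
      "\<forall>f\<in>S. pull_sieve C f R \<in> generated_topology C G (Dom C f)"
    show "R \<in> generated_topology C G X"
      unfolding gen
    proof (intro allI impI)
      fix J assume J: "?adm J"
      show "R \<in> J X"
        by (rule topology_trans[of C J X S]) (use J * in \<open>auto simp: gen\<close>)
    qed
  qed
qed

lemma (in category) generated_topology_covering:
  assumes "Y \<in> Obj C" and "G Y R" and "R \<subseteq> arrows_to C Y"
  shows "covering_family C (generated_topology C G) Y R"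
  using assms by (auto simp: covering_family_def generated_topology_def)

lemma generated_topology_least:
  assumes "is_topology C J"
    and "\<And>Y R. \<lbrakk>Y \<in> Obj C; G Y R\<rbrakk> \<Longrightarrow> covering_family C J Y R"
  shows "generated_topology C G X \<subseteq> J X"
  using assms unfolding generated_topology_def by blast

locale cat_functor = C: category C + D: category D
  for C :: "('o, 'a) cat" and D :: "('p, 'b) cat" +
  fixes u :: "('o, 'a, 'p, 'b) ftr"
  assumes is_functor: "is_functor C D u"
begin

lemma functor_Obj [simp]: "X \<in> Obj C \<Longrightarrow> on_obj u X \<in> Obj D"
  and functor_Idt [simp]: "X \<in> Obj C \<Longrightarrow> on_arr u (Idt C X) = Idt D (on_obj u X)"
  and functor_Arr [simp]: "f \<in> Arr C \<Longrightarrow> on_arr u f \<in> Arr D"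
  and functor_Dom [simp]: "f \<in> Arr C \<Longrightarrow> Dom D (on_arr u f) = on_obj u (Dom C f)"
  and functor_Cod [simp]: "f \<in> Arr C \<Longrightarrow> Cod D (on_arr u f) = on_obj u (Cod C f)"
  and functor_Comp [simp]: "\<lbrakk>f \<in> Arr C; g \<in> Arr C; Cod C f = Dom C g\<rbrakk> \<Longrightarrow>
      on_arr u (Comp C g f) = Comp D (on_arr u g) (on_arr u f)"
  using is_functor by (auto simp: is_functor_def hom_def)

end

lemma fully_faithfulD:
  assumes "fully_faithful C D u" and "X \<in> Obj C" and "Y \<in> Obj C"
  shows full: "m \<in> hom D (on_obj u X) (on_obj u Y) \<Longrightarrow> \<exists>f\<in>hom C X Y. on_arr u f = m"
    and faithful: "\<lbrakk>f \<in> hom C X Y; g \<in> hom C X Y; on_arr u f = on_arr u g\<rbrakk> \<Longrightarrow> f = g"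
proof -
  have bij: "bij_betw (on_arr u) (hom C X Y) (hom D (on_obj u X) (on_obj u Y))"
    using assms by (auto simp: fully_faithful_def)
  show "\<exists>f\<in>hom C X Y. on_arr u f = m" if "m \<in> hom D (on_obj u X) (on_obj u Y)"
  proof -
    have "m \<in> on_arr u ` hom C X Y" using bij that by (simp add: bij_betw_def)
    then show ?thesis by blast
  qed
  show "f = g" if "f \<in> hom C X Y" "g \<in> hom C X Y" "on_arr u f = on_arr u g"
    using bij that by (auto simp: bij_betw_def inj_on_def)
qed

section \<open>Small sets\<close>

lemma universeD:
  assumes "universe el"
  shows universe_inj: "inj el"
    and universe_pair: "\<exists>z. el z = {x, y}"
    and universe_subset: "A \<subseteq> el x \<Longrightarrow> \<exists>z. el z = A"
    and universe_Pow: "\<exists>z. el z = {y. el y \<subseteq> el x}"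
    and universe_UN: "\<exists>z. el z = (\<Union>i\<in>el x. el (h i))"
proof -
  note U = assms[unfolded universe_def]
  show "inj el" by (rule conjunct1[OF U])
  note U = conjunct2[OF U]
  show "\<exists>z. el z = {x, y}" by (rule conjunct1[OF U, rule_format])
  note U = conjunct2[OF U]
  show "\<exists>z. el z = A" if "A \<subseteq> el x" by (rule conjunct1[OF U, rule_format, OF that])
  note U = conjunct2[OF U]
  show "\<exists>z. el z = {y. el y \<subseteq> el x}" by (rule conjunct1[OF U, rule_format])
  note U = conjunct2[OF U]
  show "\<exists>z. el z = (\<Union>i\<in>el x. el (h i))" by (rule conjunct1[OF U, rule_format])
qed

lemma smallE:
  assumes "small el A"
  obtains x g where "bij_betw g A (el x)"
  using assms unfolding small_def by blast

lemma small_inj: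
  assumes U: "universe el" and A: "small el A" and f: "inj_on f B" and fB: "f ` B \<subseteq> A"
  shows "small el B"
proof -
  obtain x g where g: "bij_betw g A (el x)" by (rule smallE[OF A])
  have gi: "inj_on g A" and "g ` A = el x" using g by (auto simp: bij_betw_def)
  then have "g ` f ` B \<subseteq> el x" using fB by auto
  from universe_subset[OF U this] obtain z where z: "el z = g ` f ` B" by (rule exE)
  have "inj_on (g \<circ> f) B"
    using f gi fB by (auto intro: comp_inj_on inj_on_subset)
  then have "bij_betw (g \<circ> f) B (el z)"
    by (simp add: bij_betw_def z image_comp)
  then show ?thesis by (auto simp: small_def)
qed

lemma small_subset: "\<lbrakk>universe el; small el A; B \<subseteq> A\<rbrakk> \<Longrightarrow> small el B"
  using small_inj[of el A id B] by simp

lemma small_image: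
  assumes "universe el" and "small el A"
  shows "small el (f ` A)"
  by (rule small_inj[OF assms inj_on_inv_into[of _ f]]) (auto intro: inv_into_into)

lemma small_Pow:
  assumes U: "universe el" and A: "small el A"
  shows "small el (Pow A)"
proof -
  obtain x g where g: "bij_betw g A (el x)" by (rule smallE[OF A])
  obtain z where z: "el z = {y. el y \<subseteq> el x}" using universe_Pow[OF U] by (rule exE)
  have "inj el" by (rule universe_inj[OF U])
  moreover have "el ` el z = Pow (el x)"
  proof
    show "Pow (el x) \<subseteq> el ` el z"
    proof
      fix A assume "A \<in> Pow (el x)"
      then have A: "A \<subseteq> el x" by simp
      from universe_subset[OF U this] obtain y where "el y = A" by (rule exE)
      then show "A \<in> el ` el z" using A by (auto simp: z)
    qed
  qed (auto simp: z)
  ultimately have "bij_betw el (el z) (Pow (el x))"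
    by (auto simp: bij_betw_def intro: inj_on_subset)
  then have "bij_betw (inv_into (el z) el) (Pow (el x)) (el z)"
    by (rule bij_betw_inv_into)
  moreover have "bij_betw ((`) g) (Pow A) (Pow (el x))"
    by (rule bij_betw_Pow[OF g])
  ultimately have "bij_betw (inv_into (el z) el \<circ> (`) g) (Pow A) (el z)"
    by (rule bij_betw_trans[rotated])
  then show ?thesis unfolding small_def by blast
qed

text \<open>Ordered pairs of elements of the universe are coded in the manner of Kuratowski.\<close>

lemma small_Sigma:
  assumes U: "universe el" and A: "small el A" and B: "\<And>a. a \<in> A \<Longrightarrow> small el (B a)"
  shows "small el (Sigma A B)"
proof -
  obtain x g where g: "bij_betw g A (el x)" by (rule smallE[OF A])
  have "\<forall>a\<in>A. \<exists>y f. bij_betw f (B a) (el y)" using B by (auto simp: small_def)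
  then obtain y f where f: "\<And>a. a \<in> A \<Longrightarrow> bij_betw (f a) (B a) (el (y a))" by metis
  have un: "\<exists>z. el z = (\<Union>i\<in>el x. el (h i))" for x h
    by (rule universe_UN[OF U])
  have "\<forall>a b. \<exists>c. el c = {a, b}" by (intro allI universe_pair[OF U])
  then obtain up where up: "\<And>a b. el (up a b) = {a, b}" by metis
  define pr where "pr a b = up (up a a) (up a b)" for a b
  have pr: "a = a' \<and> b = b'" if "pr a b = pr a' b'" for a b a' b'
  proof -
    have "{up a a, up a b} = {up a' a', up a' b'}"
      using that up by (metis pr_def)
    moreover have "a = a' \<and> b = b'" if "up a b = up a' b'" "up a a = up a' a'"
    proof -
      have "{a, b} = {a', b'}" "{a, a} = {a', a'}" using that up by metis+
      then show ?thesis by (auto simp: doubleton_eq_iff)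
    qed
    moreover have "a = a' \<and> b = b'" if "up a a = up a' b'" "up a b = up a' a'"
    proof -
      have "{a, a} = {a', b'}" "{a, b} = {a', a'}" using that up by metis+
      then show ?thesis by (auto simp: doubleton_eq_iff)
    qed
    ultimately show ?thesis unfolding doubleton_eq_iff by blast
  qed
  have ex: "\<exists>w. el w = pr i ` el j" for i j
    using un[where x = j and h = "\<lambda>b. up (pr i b) (pr i b)"]
    by (simp add: up UNION_singleton_eq_range)
  define w where "w i j = (SOME w. el w = pr i ` el j)" for i j
  have w: "el (w i j) = pr i ` el j" for i j
    unfolding w_def by (rule someI_ex[of "\<lambda>w. el w = pr i ` el j"]) (rule ex)
  obtain z where z: "el z = (\<Union>i\<in>el x. el (w i (y (inv_into A g i))))"
    using un[where x = x and h = "\<lambda>i. w i (y (inv_into A g i))"] by (rule exE)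
  define p where "p = (\<lambda>(a, b). pr (g a) (f a b))"
  have "inj_on p (Sigma A B)"
  proof (rule inj_onI, clarify)
    fix a b a' b' assume a: "a \<in> A" "b \<in> B a" "a' \<in> A" "b' \<in> B a'" and "p (a, b) = p (a', b')"
    then have "g a = g a'" "f a b = f a' b'" using pr[of "g a" "f a b" "g a'" "f a' b'"] by (simp_all add: p_def)
    then show "a = a' \<and> b = b'"
      using a g f[of a] by (metis bij_betw_imp_inj_on inj_onD)
  qed
  moreover have "p ` Sigma A B \<subseteq> el z"
  proof clarify
    fix a b assume a: "a \<in> A" and b: "b \<in> B a"
    have "inv_into A g (g a) = a" using g a by (simp add: bij_betw_def)
    moreover have "g a \<in> el x" and "f a b \<in> el (y a)"
      using g f[OF a] a b by (auto dest: bij_betwE)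
    ultimately have "p (a, b) \<in> el (w (g a) (y (inv_into A g (g a))))"
      by (simp add: w p_def)
    then show "p (a, b) \<in> el z"
      using \<open>g a \<in> el x\<close> unfolding z by blast
  qed
  moreover have "small el (el z)" unfolding small_def using bij_betw_id by blast
  ultimately show ?thesis using small_inj[OF U] by blast
qed

lemma small_UN:
  assumes "universe el" and "small el A" and "\<And>a. a \<in> A \<Longrightarrow> small el (B a)"
  shows "small el (\<Union>a\<in>A. B a)"
proof -
  have "(\<Union>a\<in>A. B a) = snd ` Sigma A B" by force
  then show ?thesis using small_image[OF assms(1) small_Sigma[OF assms]] by simp
qed

section \<open>Sheaves\<close>

lemma sheaf_presheaf: "is_sheaf el C J F \<Longrightarrow> is_presheaf el C F"
  by (simp add: is_sheaf_def)

lemma presheafD: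
  assumes "is_presheaf el C F"
  shows restrict_in: "\<lbrakk>f \<in> Arr C; s \<in> el (section_set F (Cod C f))\<rbrakk> \<Longrightarrow>
      restrict_along F f s \<in> el (section_set F (Dom C f))"
    and restrict_Idt: "\<lbrakk>X \<in> Obj C; s \<in> el (section_set F X)\<rbrakk> \<Longrightarrow> restrict_along F (Idt C X) s = s"
    and restrict_Comp: "\<lbrakk>f \<in> Arr C; g \<in> Arr C; Cod C f = Dom C g; s \<in> el (section_set F (Cod C g))\<rbrakk>
      \<Longrightarrow> restrict_along F (Comp C g f) s = restrict_along F f (restrict_along F g s)"
  using assms by (auto simp: is_presheaf_def)

lemma sheaf_glue:
  assumes "is_sheaf el C J F" and "X \<in> Obj C" and "S \<in> J X" and "matching_family el C F S t"
  shows "\<exists>!s. s \<in> el (section_set F X) \<and> (\<forall>f\<in>S. restrict_along F f s = t f)"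
proof -
  note H = bspec[OF bspec[OF conjunct2[OF assms(1)[unfolded is_sheaf_def]] assms(2)] assms(3)]
  show ?thesis by (rule mp[OF spec[OF H] assms(4)])
qed

lemma (in category) sheaf_separated:
  assumes F: "is_sheaf el C J F" and X: "X \<in> Obj C" and R: "covering_family C J X R"
    and s: "s \<in> el (section_set F X)" and s': "s' \<in> el (section_set F X)"
    and eq: "\<And>f. f \<in> R \<Longrightarrow> restrict_along F f s = restrict_along F f s'"
  shows "s = s'"
proof -
  note P = sheaf_presheaf[OF F]
  let ?S = "sieve_generated C R"
  have Ra: "f \<in> Arr C \<and> Cod C f = X" if "f \<in> R" for f
    using R that by (auto simp: covering_family_def arrows_to_def)
  have Sa: "f \<in> Arr C \<and> Cod C f = X" if "f \<in> ?S" for f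
    using that Ra by (auto simp: sieve_generated_def arrows_to_def)
  have "matching_family el C F ?S (\<lambda>f. restrict_along F f s)"
    unfolding matching_family_def
  proof (intro ballI conjI)
    fix f assume "f \<in> ?S"
    then show "restrict_along F f s \<in> el (section_set F (Dom C f))"
      using Sa s restrict_in[OF P, of f s] by auto
  next
    fix f g assume "f \<in> ?S" "g \<in> arrows_to C (Dom C f)"
    then show "restrict_along F (Comp C f g) s = restrict_along F g (restrict_along F f s)"
      using Sa[of f] s restrict_Comp[OF P, of g f s] by (auto simp: arrows_to_def)
  qed
  from sheaf_glue[OF F X _ this] R
  have ex1: "\<exists>!s'. s' \<in> el (section_set F X) \<and> (\<forall>f\<in>?S. restrict_along F f s' = restrict_along F f s)"
    by (simp add: covering_family_def)
  have "restrict_along F f s' = restrict_along F f s" if "f \<in> ?S" for f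
  proof -
    obtain r d where r: "r \<in> R" "d \<in> Arr C" "Cod C d = Dom C r" and f: "f = Comp C r d"
      using \<open>f \<in> ?S\<close> by (auto simp: sieve_generated_def arrows_to_def)
    show ?thesis
      using r Ra[OF r(1)] s s' eq[OF r(1)] restrict_Comp[OF P, of d r] by (simp add: f)
  qed
  with ex1 s s' show ?thesis by blast
qed

text \<open>A sheaf of arbitrary sets, given by sets \<open>P X\<close> and restriction maps \<open>r f\<close>, all of whose sets
  are small is isomorphic to a sheaf with values in the universe; \<open>e X\<close> is the isomorphism.\<close>

lemma small_sheaf_representation:
  assumes C: "is_category C"
    and small: "\<And>X. X \<in> Obj C \<Longrightarrow> small el (P X)"
    and r_in: "\<And>f T. \<lbrakk>f \<in> Arr C; T \<in> P (Cod C f)\<rbrakk> \<Longrightarrow> r f T \<in> P (Dom C f)"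
    and r_Idt: "\<And>X T. \<lbrakk>X \<in> Obj C; T \<in> P X\<rbrakk> \<Longrightarrow> r (Idt C X) T = T"
    and r_Comp: "\<And>f g T. \<lbrakk>f \<in> Arr C; g \<in> Arr C; Cod C f = Dom C g; T \<in> P (Cod C g)\<rbrakk> \<Longrightarrow>
      r (Comp C g f) T = r f (r g T)"
    and glue: "\<And>X S t. \<lbrakk>X \<in> Obj C; S \<in> J X; \<And>f. f \<in> S \<Longrightarrow> t f \<in> P (Dom C f);
        \<And>f g. \<lbrakk>f \<in> S; g \<in> arrows_to C (Dom C f)\<rbrakk> \<Longrightarrow> t (Comp C f g) = r g (t f)\<rbrakk> \<Longrightarrow>
      \<exists>!T. T \<in> P X \<and> (\<forall>f\<in>S. r f T = t f)"
    and sieve: "\<And>X S. \<lbrakk>X \<in> Obj C; S \<in> J X\<rbrakk> \<Longrightarrow> S \<subseteq> arrows_to C X"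
  obtains F e where "is_sheaf el C J F"
    and "\<And>X. X \<in> Obj C \<Longrightarrow> bij_betw (e X) (P X) (el (section_set F X))"
    and "\<And>f T. \<lbrakk>f \<in> Arr C; T \<in> P (Cod C f)\<rbrakk> \<Longrightarrow>
      restrict_along F f (e (Cod C f) T) = e (Dom C f) (r f T)"
proof -
  interpret category C by unfold_locales (rule C)
  have "\<forall>X\<in>Obj C. \<exists>x g. bij_betw g (P X) (el x)"
    using small by (simp add: small_def)
  from bchoice[OF this] obtain x where "\<forall>X\<in>Obj C. \<exists>g. bij_betw g (P X) (el (x X))"
    by (rule exE)
  from bchoice[OF this] obtain e where "\<forall>X\<in>Obj C. bij_betw (e X) (P X) (el (x X))"
    by (rule exE)
  then have e: "bij_betw (e X) (P X) (el (x X))" if "X \<in> Obj C" for X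
    using that by simp
  define d where "d X = inv_into (P X) (e X)" for X
  have de: "d X (e X T) = T" if "X \<in> Obj C" "T \<in> P X" for X T
    using e[OF that(1)] that(2) by (simp add: d_def bij_betw_def)
  have ed: "e X (d X s) = s" if "X \<in> Obj C" "s \<in> el (x X)" for X s
    using e[OF that(1)] that(2) unfolding d_def by (rule bij_betw_inv_into_right)
  have d_in: "d X s \<in> P X" if "X \<in> Obj C" "s \<in> el (x X)" for X s
    using e[OF that(1)] that(2) by (simp add: d_def bij_betw_def inv_into_into)
  have e_in: "e X T \<in> el (x X)" if "X \<in> Obj C" "T \<in> P X" for X T
    using e[OF that(1)] that(2) by (auto dest: bij_betwE)
  define F where "F = \<lparr>section_set = x, restrict_along = (\<lambda>f s. e (Dom C f) (r f (d (Cod C f) s)))\<rparr>"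
  have F: "section_set F X = x X" "restrict_along F f s = e (Dom C f) (r f (d (Cod C f) s))" for X f s
    by (simp_all add: F_def)
  have "is_presheaf el C F"
    unfolding is_presheaf_def F
    using e_in r_in d_in by (simp add: r_Idt r_Comp ed de)
  moreover have "\<exists>!s. s \<in> el (section_set F X) \<and> (\<forall>f\<in>S. restrict_along F f s = t f)"
    if X: "X \<in> Obj C" and S: "S \<in> J X" and t: "matching_family el C F S t" for X S t
  proof -
    have Sa: "f \<in> Arr C \<and> Cod C f = X" if "f \<in> S" for f
      using sieve[OF X S] that by (auto simp: arrows_to_def)
    have t_in: "t f \<in> el (x (Dom C f))" if "f \<in> S" for f
      using t that by (simp add: matching_family_def F)
    have tc: "t (Comp C f g) = e (Dom C g) (r g (d (Dom C f) (t f)))"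
      if "f \<in> S" "g \<in> Arr C" "Cod C g = Dom C f" for f g
      using t that by (simp add: matching_family_def F arrows_to_def)
    have "\<exists>!T. T \<in> P X \<and> (\<forall>f\<in>S. r f T = d (Dom C f) (t f))"
      by (rule glue[OF X S])
        (use Sa t_in in \<open>auto simp: arrows_to_def d_in tc de r_in\<close>)
    then obtain T where T: "T \<in> P X" "\<And>f. f \<in> S \<Longrightarrow> r f T = d (Dom C f) (t f)"
      and uniq: "\<And>T'. \<lbrakk>T' \<in> P X; \<forall>f\<in>S. r f T' = d (Dom C f) (t f)\<rbrakk> \<Longrightarrow> T' = T"
      by (auto elim!: ex1E)
    show ?thesis
    proof (intro ex1I[of _ "e X T"] conjI ballI)
      show "e X T \<in> el (section_set F X)"
        using e_in X T by (simp add: F)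
      show "restrict_along F f (e X T) = t f" if "f \<in> S" for f
        using Sa[OF that] T that X t_in[OF that] by (simp add: F de ed)
    next
      fix s assume s: "s \<in> el (section_set F X) \<and> (\<forall>f\<in>S. restrict_along F f s = t f)"
      have "d X s = T"
      proof (rule uniq)
        show "d X s \<in> P X" using s X by (simp add: F d_in)
        show "\<forall>f\<in>S. r f (d X s) = d (Dom C f) (t f)"
        proof
          fix f assume f: "f \<in> S"
          then have "e (Dom C f) (r f (d X s)) = t f"
            using bspec[OF conjunct2[OF s] f] Sa[OF f] by (simp add: F)
          then show "r f (d X s) = d (Dom C f) (t f)"
            using de[of "Dom C f" "r f (d X s)"] Sa[OF f] r_in[of f "d X s"] s X by (simp add: F d_in)
        qed
      qed
      then show "s = e X T" using ed[of X s] s X by (simp add: F)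
    qed
  qed
  ultimately have "is_sheaf el C J F"
    unfolding is_sheaf_def by blast
  then show thesis
    by (rule that[where e = e]) (simp_all add: F e de)
qed

section \<open>The sheaf of closed sieves\<close>

text \<open>A functor is cocontinuous if the preimage of a covering sieve under every arrow from the
  image of an object is covering.\<close>

definition functor_pull ::
  "('o, 'a) cat \<Rightarrow> ('p, 'b) cat \<Rightarrow> ('o, 'a, 'p, 'b) ftr \<Rightarrow> 'o \<Rightarrow> 'b \<Rightarrow> 'b set \<Rightarrow> 'a set" where
  "functor_pull C' C u Y m S = {g \<in> arrows_to C' Y. Comp C m (on_arr u g) \<in> S}"

definition cocontinuous ::
  "('o, 'a) cat \<Rightarrow> ('o, 'a) topol \<Rightarrow> ('p, 'b) cat \<Rightarrow> ('p, 'b) topol \<Rightarrow> ('o, 'a, 'p, 'b) ftr \<Rightarrow> bool" where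
  "cocontinuous C' J' C J u \<longleftrightarrow>
     (\<forall>V\<in>Obj C. \<forall>S\<in>J V. \<forall>Y\<in>Obj C'. \<forall>m\<in>hom C (on_obj u Y) V. functor_pull C' C u Y m S \<in> J' Y)"

text \<open>The objects of the comma category of \<open>u\<close> over \<open>V\<close>.  They are pairs of an object \<open>Y\<close> and an arrow
  from \<open>u Y\<close> to \<open>V\<close>, since \<open>u\<close> need not be injective on objects.\<close>

definition comma :: "('o, 'a) cat \<Rightarrow> ('p, 'b) cat \<Rightarrow> ('o, 'a, 'p, 'b) ftr \<Rightarrow> 'p \<Rightarrow> ('o \<times> 'b) set" where
  "comma C' C u V = {(Y, m). Y \<in> Obj C' \<and> m \<in> hom C (on_obj u Y) V}"

text \<open>The restriction of a sieve \<open>T\<close> of the comma category to a sieve of \<open>Y\<close>, along an object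
  \<open>(Y, m)\<close>.\<close>

definition comma_pull ::
  "('o, 'a) cat \<Rightarrow> ('p, 'b) cat \<Rightarrow> ('o, 'a, 'p, 'b) ftr \<Rightarrow> ('o \<times> 'b) set \<Rightarrow> 'o \<Rightarrow> 'b \<Rightarrow> 'a set" where
  "comma_pull C' C u T Y m = {g \<in> arrows_to C' Y. (Dom C' g, Comp C m (on_arr u g)) \<in> T}"

text \<open>The sieves of the comma category over \<open>V\<close> that are closed for \<open>J'\<close>: a pair \<open>(Y, m)\<close> that lies in
  such a sieve locally on \<open>Y\<close> belongs to it.  They are the sections over \<open>V\<close> of the direct image of
  the sheaf of closed sieves.\<close>

definition closed_comma_sieves ::
  "('o, 'a) cat \<Rightarrow> ('o, 'a) topol \<Rightarrow> ('p, 'b) cat \<Rightarrow> ('o, 'a, 'p, 'b) ftr \<Rightarrow> 'p \<Rightarrow> ('o \<times> 'b) set set" where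
  "closed_comma_sieves C' J' C u V =
     {T. T \<subseteq> comma C' C u V \<and>
         (\<forall>Y m. (Y, m) \<in> T \<longrightarrow> comma_pull C' C u T Y m = arrows_to C' Y) \<and>
         (\<forall>Y m. (Y, m) \<in> comma C' C u V \<longrightarrow> comma_pull C' C u T Y m \<in> J' Y \<longrightarrow> (Y, m) \<in> T)}"

text \<open>The restriction map of the sheaf of closed comma sieves along \<open>f\<close>.\<close>

definition comma_restrict ::
  "('o, 'a) cat \<Rightarrow> ('p, 'b) cat \<Rightarrow> ('o, 'a, 'p, 'b) ftr \<Rightarrow> 'b \<Rightarrow> ('o \<times> 'b) set \<Rightarrow> ('o \<times> 'b) set" where
  "comma_restrict C' C u f T = {(Y, m) \<in> comma C' C u (Dom C f). (Y, Comp C f m) \<in> T}"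

context cat_functor
begin

abbreviation "cm \<equiv> comma C D u"
abbreviation "pl \<equiv> comma_pull C D u"
abbreviation "rs \<equiv> comma_restrict C D u"
abbreviation "ccs J \<equiv> closed_comma_sieves C J D u"

lemma comma_iff: "(Y, m) \<in> cm V \<longleftrightarrow> Y \<in> Obj C \<and> m \<in> Arr D \<and> Dom D m = on_obj u Y \<and> Cod D m = V"
  by (auto simp: comma_def hom_def)

lemma comma_pull_iff:
  "g \<in> pl T Y m \<longleftrightarrow> g \<in> Arr C \<and> Cod C g = Y \<and> (Dom C g, Comp D m (on_arr u g)) \<in> T"
  by (auto simp: comma_pull_def arrows_to_def)

lemma comma_restrict_iff: "(Y, m) \<in> rs f T \<longleftrightarrow> (Y, m) \<in> cm (Dom D f) \<and> (Y, Comp D f m) \<in> T"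
  by (auto simp: comma_restrict_def)

lemma ccs_subset: "\<lbrakk>T \<in> ccs J V; (Y, m) \<in> T\<rbrakk> \<Longrightarrow> (Y, m) \<in> cm V"
  by (auto simp: closed_comma_sieves_def)

lemma ccs_sieve:
  assumes "T \<in> ccs J V" and "(Y, m) \<in> T" and "g \<in> Arr C" and "Cod C g = Y"
  shows "(Dom C g, Comp D m (on_arr u g)) \<in> T"
proof -
  have "pl T Y m = arrows_to C Y"
    using assms(1,2) by (simp add: closed_comma_sieves_def)
  then have "g \<in> pl T Y m" using assms(3,4) by (simp add: arrows_to_def)
  then show ?thesis by (simp add: comma_pull_iff)
qed

lemma ccs_closed: "\<lbrakk>T \<in> ccs J V; (Y, m) \<in> cm V; pl T Y m \<in> J Y\<rbrakk> \<Longrightarrow> (Y, m) \<in> T"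
  unfolding closed_comma_sieves_def by blast

lemma ccsI:
  assumes "\<And>Y m. (Y, m) \<in> T \<Longrightarrow> (Y, m) \<in> cm V"
    and "\<And>Y m g. \<lbrakk>(Y, m) \<in> T; g \<in> Arr C; Cod C g = Y\<rbrakk> \<Longrightarrow> (Dom C g, Comp D m (on_arr u g)) \<in> T"
    and "\<And>Y m. \<lbrakk>(Y, m) \<in> cm V; pl T Y m \<in> J Y\<rbrakk> \<Longrightarrow> (Y, m) \<in> T"
  shows "T \<in> ccs J V"
  unfolding closed_comma_sieves_def
proof (intro CollectI conjI allI impI)
  show "T \<subseteq> cm V" using assms(1) by auto
  show "pl T Y m = arrows_to C Y" if "(Y, m) \<in> T" for Y m
    using assms(2)[OF that] by (auto simp: comma_pull_iff arrows_to_def)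
qed (rule assms(3))

lemma pl_sieve:
  assumes T: "T \<in> ccs J V" and m: "(Y, m) \<in> cm V"
  shows "is_sieve C Y (pl T Y m)"
  unfolding is_sieve_def
proof (intro conjI ballI)
  show "pl T Y m \<subseteq> arrows_to C Y"
    by (auto simp: comma_pull_iff arrows_to_def)
next
  fix f g assume f: "f \<in> pl T Y m" and g: "g \<in> arrows_to C (Dom C f)"
  have "(Dom C g, Comp D (Comp D m (on_arr u f)) (on_arr u g)) \<in> T"
    using ccs_sieve[OF T, of "Dom C f" _ g] f g by (simp add: comma_pull_iff arrows_to_def)
  then show "Comp C f g \<in> pl T Y m"
    using f g m by (simp add: comma_pull_iff arrows_to_def comma_iff)
qed

lemma comma_restrict_pull:
  assumes "f \<in> Arr D" and "(Y, m) \<in> cm (Dom D f)"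
  shows "pl (rs f T) Y m = pl T Y (Comp D f m)"
  using assms by (auto simp: comma_pull_iff comma_restrict_iff comma_iff)

lemma comma_restrict_ccs:
  assumes f: "f \<in> Arr D" and T: "T \<in> ccs J (Cod D f)"
  shows "rs f T \<in> ccs J (Dom D f)"
proof (rule ccsI)
  show "(Y, m) \<in> cm (Dom D f)" if "(Y, m) \<in> rs f T" for Y m
    using that by (simp add: comma_restrict_iff)
next
  fix Y m g assume "(Y, m) \<in> rs f T" and g: "g \<in> Arr C" "Cod C g = Y"
  then have m: "(Y, m) \<in> cm (Dom D f)" and "(Y, Comp D f m) \<in> T"
    by (auto simp: comma_restrict_iff)
  from ccs_sieve[OF T this(2) g] show "(Dom C g, Comp D m (on_arr u g)) \<in> rs f T"
    using m f g by (simp add: comma_restrict_iff comma_iff)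
next
  fix Y m assume m: "(Y, m) \<in> cm (Dom D f)" and "pl (rs f T) Y m \<in> J Y"
  then have "pl T Y (Comp D f m) \<in> J Y" using f by (simp add: comma_restrict_pull)
  moreover have "(Y, Comp D f m) \<in> cm (Cod D f)" using m f by (simp add: comma_iff)
  ultimately show "(Y, m) \<in> rs f T"
    using m ccs_closed[OF T] by (simp add: comma_restrict_iff)
qed

text \<open>The closed sieves form a sheaf.\<close>

lemma ccs_glue:
  assumes J: "is_topology C J" and K: "is_topology D K" and coc: "cocontinuous C J D K u"
    and V: "V \<in> Obj D" and S: "S \<in> K V"
    and t: "\<And>f. f \<in> S \<Longrightarrow> t f \<in> ccs J (Dom D f)"
    and t_rs: "\<And>f g. \<lbrakk>f \<in> S; g \<in> arrows_to D (Dom D f)\<rbrakk> \<Longrightarrow> t (Comp D f g) = rs g (t f)"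
  shows "\<exists>!T. T \<in> ccs J V \<and> (\<forall>f\<in>S. rs f T = t f)"
proof -
  have Sa: "f \<in> Arr D \<and> Cod D f = V" if "f \<in> S" for f
    using topology_sieve[OF K V S] that by (auto simp: is_sieve_def arrows_to_def)
  have S_comp: "Comp D f g \<in> S" if "f \<in> S" "g \<in> Arr D" "Cod D g = Dom D f" for f g
    using topology_sieve[OF K V S] that by (auto simp: is_sieve_def arrows_to_def)
  have pullS: "functor_pull C D u Y m S \<in> J Y" if "(Y, m) \<in> cm V" for Y m
    using coc V S that unfolding cocontinuous_def comma_iff hom_def by blast
  \<comment> \<open>The glued sieve consists of the arrows that locally lie in the given ones.\<close>
  define Q where "Q Y m = {g \<in> Arr C. Cod C g = Y \<and> Comp D m (on_arr u g) \<in> S \<and>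
    (Dom C g, Idt D (on_obj u (Dom C g))) \<in> t (Comp D m (on_arr u g))}" for Y m
  define T where "T = {(Y, m) \<in> cm V. Q Y m \<in> J Y}"
  have Q_comp: "Comp C g h \<in> Q Y m"
    if m: "(Y, m) \<in> cm V" and g: "g \<in> Q Y m" and h: "h \<in> Arr C" "Cod C h = Dom C g" for Y m g h
  proof -
    let ?n = "Comp D m (on_arr u g)"
    have g': "g \<in> Arr C" "Cod C g = Y" and n: "?n \<in> S"
      and id: "(Dom C g, Idt D (on_obj u (Dom C g))) \<in> t ?n"
      using g by (auto simp: Q_def)
    have "Dom D ?n = on_obj u (Dom C g)" using m g' by (simp add: comma_iff)
    have "(Dom C h, on_arr u h) \<in> t ?n"
      using ccs_sieve[OF t[OF n] id h(1)] h g' by simp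
    then have "(Dom C h, Idt D (on_obj u (Dom C h))) \<in> rs (on_arr u h) (t ?n)"
      using h by (simp add: comma_restrict_iff comma_iff)
    moreover have "rs (on_arr u h) (t ?n) = t (Comp D ?n (on_arr u h))"
      using t_rs[OF n, of "on_arr u h"] h g' m by (simp add: arrows_to_def comma_iff)
    moreover have "Comp D ?n (on_arr u h) \<in> S"
      using S_comp[OF n, of "on_arr u h"] h g' m by (simp add: comma_iff)
    ultimately show ?thesis
      using g' h m by (simp add: Q_def comma_iff)
  qed
  have Q_sieve: "is_sieve C Y (Q Y m)" if "(Y, m) \<in> cm V" for Y m
    unfolding is_sieve_def using Q_comp[OF that] by (auto simp: Q_def arrows_to_def)
  have Q_pull: "Q (Dom C g) (Comp D m (on_arr u g)) = pull_sieve C g (Q Y m)"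
    if m: "(Y, m) \<in> cm V" and g: "g \<in> Arr C" "Cod C g = Y" for Y m g
    using m g by (auto simp: Q_def pull_sieve_def arrows_to_def comma_iff)
  have cmg: "(Dom C g, Comp D m (on_arr u g)) \<in> cm V"
    if "(Y, m) \<in> cm V" "g \<in> Arr C" "Cod C g = Y" for Y m g
    using that by (simp add: comma_iff)
  have T_ccs: "T \<in> ccs J V"
  proof (rule ccsI)
    show "(Y, m) \<in> cm V" if "(Y, m) \<in> T" for Y m using that by (simp add: T_def)
  next
    fix Y m g assume T: "(Y, m) \<in> T" and g: "g \<in> Arr C" "Cod C g = Y"
    then have m: "(Y, m) \<in> cm V" and "Q Y m \<in> J Y" by (auto simp: T_def)
    then have "pull_sieve C g (Q Y m) \<in> J (Dom C g)"
      using topology_pull[OF J, of Y "Q Y m" g] g by (auto simp: arrows_to_def)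
    then show "(Dom C g, Comp D m (on_arr u g)) \<in> T"
      using cmg[OF m g] Q_pull[OF m g] by (simp add: T_def)
  next
    fix Y m assume m: "(Y, m) \<in> cm V" and pl: "pl T Y m \<in> J Y"
    have "Q Y m \<in> J Y"
    proof (rule topology_trans[OF J _ pl Q_sieve[OF m]])
      show "Y \<in> Obj C" using m by (simp add: comma_iff)
      fix g assume "g \<in> pl T Y m"
      then have g: "g \<in> Arr C" "Cod C g = Y" and "(Dom C g, Comp D m (on_arr u g)) \<in> T"
        by (auto simp: comma_pull_iff)
      then show "pull_sieve C g (Q Y m) \<in> J (Dom C g)"
        using Q_pull[OF m g] by (simp add: T_def)
    qed
    then show "(Y, m) \<in> T" using m by (simp add: T_def)
  qed
  have T_glue: "rs f T = t f" if f: "f \<in> S" for f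
  proof -
    have "(Y, n) \<in> rs f T \<longleftrightarrow> (Y, n) \<in> t f" if n: "(Y, n) \<in> cm (Dom D f)" for Y n
    proof -
      have fn: "(Y, Comp D f n) \<in> cm V"
        using n Sa[OF f] by (simp add: comma_iff)
      have "Q Y (Comp D f n) = pl (t f) Y n"
      proof -
        have "g \<in> Q Y (Comp D f n) \<longleftrightarrow> g \<in> pl (t f) Y n" if g: "g \<in> Arr C" "Cod C g = Y" for g
        proof -
          let ?k = "Comp D n (on_arr u g)"
          have k: "?k \<in> Arr D" "Cod D ?k = Dom D f" "Dom D ?k = on_obj u (Dom C g)"
            using n g by (auto simp: comma_iff)
          have "t (Comp D f ?k) = rs ?k (t f)"
            using t_rs[OF f, of ?k] k by (simp add: arrows_to_def)
          then show ?thesis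
            using S_comp[OF f k(1,2)] k g n Sa[OF f]
            by (simp add: Q_def comma_pull_iff comma_restrict_iff comma_iff)
        qed
        moreover have "g \<in> Arr C \<and> Cod C g = Y"
          if "g \<in> Q Y (Comp D f n) \<or> g \<in> pl (t f) Y n" for g
          using that by (auto simp: Q_def comma_pull_iff)
        ultimately show ?thesis by blast
      qed
      moreover have "(Y, n) \<in> t f \<longleftrightarrow> pl (t f) Y n \<in> J Y"
      proof
        assume "(Y, n) \<in> t f"
        then have "pl (t f) Y n = arrows_to C Y"
          using ccs_sieve[OF t[OF f]] by (auto simp: comma_pull_iff arrows_to_def)
        then show "pl (t f) Y n \<in> J Y"
          using topology_max[OF J] n by (simp add: comma_iff)
      qed (rule ccs_closed[OF t[OF f] n])
      ultimately show ?thesis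
        using fn n by (simp add: comma_restrict_iff T_def)
    qed
    moreover have "(Y, n) \<in> cm (Dom D f)" if "(Y, n) \<in> rs f T \<or> (Y, n) \<in> t f" for Y n
      using that ccs_subset[OF t[OF f]] by (auto simp: comma_restrict_iff)
    ultimately show ?thesis by auto
  qed
  have uniq: "T1 \<subseteq> T2"
    if T1: "T1 \<in> ccs J V" and T2: "T2 \<in> ccs J V" and eq: "\<And>f. f \<in> S \<Longrightarrow> rs f T1 = rs f T2"
    for T1 T2
  proof clarify
    fix Y m assume m1: "(Y, m) \<in> T1"
    have m: "(Y, m) \<in> cm V" by (rule ccs_subset[OF T1 m1])
    have "functor_pull C D u Y m S \<subseteq> pl T2 Y m"
    proof
      fix g assume "g \<in> functor_pull C D u Y m S"
      then have g: "g \<in> Arr C" "Cod C g = Y" and n: "Comp D m (on_arr u g) \<in> S"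
        by (auto simp: functor_pull_def arrows_to_def)
      have "(Dom C g, Idt D (on_obj u (Dom C g))) \<in> rs (Comp D m (on_arr u g)) T1"
        using ccs_sieve[OF T1 m1 g] m g by (simp add: comma_restrict_iff comma_iff)
      then have "(Dom C g, Comp D m (on_arr u g)) \<in> T2"
        unfolding eq[OF n] using m g by (simp add: comma_restrict_iff comma_iff)
      then show "g \<in> pl T2 Y m" using g by (simp add: comma_pull_iff)
    qed
    then have "pl T2 Y m \<in> J Y"
      using C.topology_mono[OF J _ pullS[OF m] pl_sieve[OF T2 m]] m by (simp add: comma_iff)
    then show "(Y, m) \<in> T2" by (rule ccs_closed[OF T2 m])
  qed
  show ?thesis
  proof (rule ex1I[of _ T])
    show "T \<in> ccs J V \<and> (\<forall>f\<in>S. rs f T = t f)" using T_ccs T_glue by blast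
    show "T' = T" if "T' \<in> ccs J V \<and> (\<forall>f\<in>S. rs f T' = t f)" for T'
      using uniq[of T' T] uniq[of T T'] that T_ccs T_glue by (metis subset_antisym)
  qed
qed

text \<open>A closed sieve is determined by its members with source in a generating family, and these
  form a small set.\<close>

lemma small_ccs:
  assumes U: "universe el" and J: "is_topology C J" and G: "G \<subseteq> Obj C" "small el G"
    and gen: "\<And>X. X \<in> Obj C \<Longrightarrow> \<exists>R. covering_family C J X R \<and> (\<forall>f\<in>R. Dom C f \<in> G)"
    and ls: "locally_small el D" and V: "V \<in> Obj D"
  shows "small el (ccs J V)"
proof -
  let ?B = "SIGMA Y : G. hom D (on_obj u Y) V"
  have "small el ?B"
  proof (rule small_Sigma[OF U G(2)])
    fix Y assume "Y \<in> G"
    then show "small el (hom D (on_obj u Y) V)"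
      using ls G(1) V by (auto simp: locally_small_def)
  qed
  then have Pow: "small el (Pow ?B)" by (rule small_Pow[OF U])
  have incl: "T1 \<subseteq> T2" if T1: "T1 \<in> ccs J V" and T2: "T2 \<in> ccs J V" and eq: "T1 \<inter> ?B = T2 \<inter> ?B"
    for T1 T2
  proof clarify
    fix Y m assume m1: "(Y, m) \<in> T1"
    have m: "(Y, m) \<in> cm V" by (rule ccs_subset[OF T1 m1])
    then have Y: "Y \<in> Obj C" by (simp add: comma_iff)
    obtain R where R: "covering_family C J Y R" "\<forall>f\<in>R. Dom C f \<in> G" using gen[OF Y] by blast
    have "R \<subseteq> pl T2 Y m"
    proof
      fix g assume g: "g \<in> R"
      then have ga: "g \<in> Arr C" "Cod C g = Y" using R(1) by (auto simp: covering_family_def arrows_to_def)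
      then have "(Dom C g, Comp D m (on_arr u g)) \<in> T1" by (rule ccs_sieve[OF T1 m1])
      moreover have "(Dom C g, Comp D m (on_arr u g)) \<in> ?B"
        using R(2) g ga m by (simp add: comma_iff hom_def)
      ultimately show "g \<in> pl T2 Y m" using eq ga by (auto simp: comma_pull_iff)
    qed
    then have "pl T2 Y m \<in> J Y"
      by (rule C.covering_family_mono[OF J Y R(1) pl_sieve[OF T2 m]])
    then show "(Y, m) \<in> T2" by (rule ccs_closed[OF T2 m])
  qed
  show ?thesis
  proof (rule small_inj[OF U Pow])
    show "inj_on (\<lambda>T. T \<inter> ?B) (ccs J V)"
      by (rule inj_onI, rule subset_antisym; rule incl) auto
  qed auto
qed

text \<open>Along a fully faithful cocontinuous functor, the sheaves of closed sieves recognize covering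
  sieves: a sieve along whose image all sheaves are separated is covering.\<close>

lemma covering_if_separated:
  assumes U: "universe el" and J: "is_topology C J" and K: "is_topology D K"
    and coc: "cocontinuous C J D K u" and ff: "fully_faithful C D u"
    and G: "G \<subseteq> Obj C" "small el G"
    and gen: "\<And>X. X \<in> Obj C \<Longrightarrow> \<exists>R. covering_family C J X R \<and> (\<forall>f\<in>R. Dom C f \<in> G)"
    and ls: "locally_small el D"
    and X: "X \<in> Obj C" and R: "is_sieve C X R"
    and sep: "\<And>F s t. \<lbrakk>is_sheaf el D K F; s \<in> el (section_set F (on_obj u X));
        t \<in> el (section_set F (on_obj u X));
        \<And>f. f \<in> R \<Longrightarrow> restrict_along F (on_arr u f) s = restrict_along F (on_arr u f) t\<rbrakk> \<Longrightarrow> s = t"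
  shows "R \<in> J X"
proof -
  obtain F e where F: "is_sheaf el D K F"
    and e: "\<And>X. X \<in> Obj D \<Longrightarrow> bij_betw (e X) (ccs J X) (el (section_set F X))"
    and e_rs: "\<And>f T. \<lbrakk>f \<in> Arr D; T \<in> ccs J (Cod D f)\<rbrakk> \<Longrightarrow>
      restrict_along F f (e (Cod D f) T) = e (Dom D f) (rs f T)"
  proof (rule small_sheaf_representation[of D el "ccs J" rs K])
    show "is_category D" by (rule D.is_category)
    show "small el (ccs J V)" if "V \<in> Obj D" for V
      by (rule small_ccs[OF U J G gen ls that])
    show "rs f T \<in> ccs J (Dom D f)" if "f \<in> Arr D" "T \<in> ccs J (Cod D f)" for f T
      using that by (rule comma_restrict_ccs)
    show "rs (Idt D V) T = T" if "V \<in> Obj D" "T \<in> ccs J V" for V T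
      using that(1) ccs_subset[OF that(2)] by (auto simp: comma_restrict_iff) (auto simp: comma_iff)
    show "rs (Comp D g f) T = rs f (rs g T)"
      if "f \<in> Arr D" "g \<in> Arr D" "Cod D f = Dom D g" "T \<in> ccs J (Cod D g)" for f g T
      using that(1-3) by (auto simp: comma_restrict_iff comma_iff)
    show "\<exists>!T. T \<in> ccs J V \<and> (\<forall>f\<in>S. rs f T = t f)"
      if "V \<in> Obj D" "S \<in> K V" "\<And>f. f \<in> S \<Longrightarrow> t f \<in> ccs J (Dom D f)"
        "\<And>f g. \<lbrakk>f \<in> S; g \<in> arrows_to D (Dom D f)\<rbrakk> \<Longrightarrow> t (Comp D f g) = rs g (t f)" for V S t
      by (rule ccs_glue[OF J K coc that])
    show "S \<subseteq> arrows_to D V" if "V \<in> Obj D" "S \<in> K V" for V S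
      using topology_sieve[OF K that] by (simp add: is_sieve_def)
  qed (rule that)
  have Ra: "f \<in> Arr C \<and> Cod C f = X" if "f \<in> R" for f
    using R that by (auto simp: is_sieve_def arrows_to_def)
  have R_comp: "Comp C f g \<in> R" if "f \<in> R" "g \<in> Arr C" "Cod C g = Dom C f" for f g
    using R that by (auto simp: is_sieve_def arrows_to_def)
  \<comment> \<open>Members of \<open>R\<close> are recognized by their images and their sources, as \<open>u\<close> may identify objects.\<close>
  define M where "M Y m = {h \<in> Arr C. Cod C h = Y \<and>
    (\<exists>r\<in>R. Dom C r = Dom C h \<and> on_arr u r = Comp D m (on_arr u h))}" for Y m
  \<comment> \<open>The closure of the image of \<open>R\<close>, to be compared with the maximal sieve.\<close>
  define T where "T = {(Y, m) \<in> cm (on_obj u X). M Y m \<in> J Y}"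
  have uX: "on_obj u X \<in> Obj D" using X by simp
  have M_pull: "M (Dom C g) (Comp D m (on_arr u g)) = pull_sieve C g (M Y m)"
    if m: "(Y, m) \<in> cm (on_obj u X)" and g: "g \<in> Arr C" "Cod C g = Y" for Y m g
    using m g by (auto simp: M_def pull_sieve_def arrows_to_def comma_iff)
  have M_sieve: "is_sieve C Y (M Y m)" if m: "(Y, m) \<in> cm (on_obj u X)" for Y m
    unfolding is_sieve_def
  proof (intro conjI ballI)
    show "M Y m \<subseteq> arrows_to C Y" by (auto simp: M_def arrows_to_def)
  next
    fix h k assume h: "h \<in> M Y m" and k: "k \<in> arrows_to C (Dom C h)"
    then obtain r where r: "r \<in> R" "Dom C r = Dom C h" "on_arr u r = Comp D m (on_arr u h)"
      and h': "h \<in> Arr C" "Cod C h = Y" and k': "k \<in> Arr C" "Cod C k = Dom C h"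
      by (auto simp: M_def arrows_to_def)
    have "Comp C r k \<in> R" using R_comp r k' by simp
    moreover have "Dom C (Comp C r k) = Dom C (Comp C h k)"
      and "on_arr u (Comp C r k) = Comp D m (on_arr u (Comp C h k))"
      using Ra[OF r(1)] r h' k' m by (auto simp: comma_iff)
    ultimately show "Comp C h k \<in> M Y m"
      using h' k' by (auto simp: M_def)
  qed
  have T: "T \<in> ccs J (on_obj u X)"
  proof (rule ccsI)
    show "(Y, m) \<in> cm (on_obj u X)" if "(Y, m) \<in> T" for Y m using that by (simp add: T_def)
  next
    fix Y m g assume T: "(Y, m) \<in> T" and g: "g \<in> Arr C" "Cod C g = Y"
    then have m: "(Y, m) \<in> cm (on_obj u X)" and "M Y m \<in> J Y" by (auto simp: T_def)
    then have "pull_sieve C g (M Y m) \<in> J (Dom C g)"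
      using topology_pull[OF J, of Y "M Y m" g] g by (auto simp: arrows_to_def)
    then show "(Dom C g, Comp D m (on_arr u g)) \<in> T"
      using m g M_pull[OF m g] by (simp add: T_def comma_iff)
  next
    fix Y m assume m: "(Y, m) \<in> cm (on_obj u X)" and pl: "pl T Y m \<in> J Y"
    have "M Y m \<in> J Y"
    proof (rule topology_trans[OF J _ pl M_sieve[OF m]])
      show "Y \<in> Obj C" using m by (simp add: comma_iff)
      fix g assume "g \<in> pl T Y m"
      then have g: "g \<in> Arr C" "Cod C g = Y" and "(Dom C g, Comp D m (on_arr u g)) \<in> T"
        by (auto simp: comma_pull_iff)
      then show "pull_sieve C g (M Y m) \<in> J (Dom C g)"
        using M_pull[OF m g] by (simp add: T_def)
    qed
    then show "(Y, m) \<in> T" using m by (simp add: T_def)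
  qed
  have top: "cm (on_obj u X) \<in> ccs J (on_obj u X)"
    by (rule ccsI) (auto simp: comma_iff)
  have rs_T: "rs (on_arr u f) T = rs (on_arr u f) (cm (on_obj u X))" if f: "f \<in> R" for f
  proof -
    have "(Y, Comp D (on_arr u f) m) \<in> T" if m: "(Y, m) \<in> cm (on_obj u (Dom C f))" for Y m
    proof -
      have Y: "Y \<in> Obj C" and fa: "f \<in> Arr C" "Cod C f = X" using m Ra[OF f] by (auto simp: comma_iff)
      have "m \<in> hom D (on_obj u Y) (on_obj u (Dom C f))"
        using m by (simp add: comma_iff hom_def)
      from full[OF ff Y _ this] obtain k where k: "k \<in> Arr C" "Dom C k = Y" "Cod C k = Dom C f" "on_arr u k = m"
        using fa by (auto simp: hom_def)
      have "M Y (Comp D (on_arr u f) m) = arrows_to C Y"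
      proof -
        have "h \<in> M Y (Comp D (on_arr u f) m)" if h: "h \<in> Arr C" "Cod C h = Y" for h
        proof -
          have "Comp C f (Comp C k h) \<in> R"
            using R_comp[OF f, of "Comp C k h"] k h by simp
          then show ?thesis
            unfolding M_def using h k fa by (auto intro!: bexI[of _ "Comp C f (Comp C k h)"])
        qed
        then show ?thesis by (auto simp: M_def arrows_to_def)
      qed
      then show ?thesis
        using topology_max[OF J Y] k fa by (auto simp: T_def comma_iff)
    qed
    moreover have "(Y, Comp D (on_arr u f) m) \<in> cm (on_obj u X)"
      if m: "(Y, m) \<in> cm (on_obj u (Dom C f))" for Y m
      using m Ra[OF f] by (auto simp: comma_iff)
    ultimately show ?thesis
      using Ra[OF f] by (auto simp: comma_restrict_iff)
  qed
  have "e (on_obj u X) T = e (on_obj u X) (cm (on_obj u X))"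
  proof (rule sep[OF F])
    show "e (on_obj u X) T \<in> el (section_set F (on_obj u X))"
      and "e (on_obj u X) (cm (on_obj u X)) \<in> el (section_set F (on_obj u X))"
      using e[OF uX] T top by (auto dest: bij_betwE)
  next
    fix f assume f: "f \<in> R"
    then show "restrict_along F (on_arr u f) (e (on_obj u X) T) =
        restrict_along F (on_arr u f) (e (on_obj u X) (cm (on_obj u X)))"
      using e_rs[of "on_arr u f"] Ra[OF f] T top rs_T[OF f] by simp
  qed
  then have "T = cm (on_obj u X)"
    using inj_onD[OF bij_betw_imp_inj_on[OF e[OF uX]]] T top by blast
  then have "(X, Idt D (on_obj u X)) \<in> T" using X by (simp add: comma_iff)
  then have "M X (Idt D (on_obj u X)) \<in> J X" by (simp add: T_def)
  moreover have "M X (Idt D (on_obj u X)) = R"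
  proof
    show "M X (Idt D (on_obj u X)) \<subseteq> R"
    proof
      fix h assume "h \<in> M X (Idt D (on_obj u X))"
      then obtain r where r: "r \<in> R" "Dom C r = Dom C h" "on_arr u r = on_arr u h"
        and h: "h \<in> Arr C" "Cod C h = X"
        by (auto simp: M_def)
      have "r = h"
        by (rule faithful[OF ff, of "Dom C h" X]) (use r h Ra[OF r(1)] X in \<open>auto simp: hom_def\<close>)
      then show "h \<in> R" using r by simp
    qed
    show "R \<subseteq> M X (Idt D (on_obj u X))"
      using Ra by (auto simp: M_def)
  qed
  ultimately show ?thesis by simp
qed

end

section \<open>Continuous functors and induced topologies\<close>

lemma U_siteD:
  assumes "U_site el C J"
  shows U_site_category: "is_category C" and U_site_locally_small: "locally_small el C"
    and U_site_topology: "is_topology C J"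
    and U_site_generators: "\<exists>G \<subseteq> Obj C. small el G \<and>
        (\<forall>X\<in>Obj C. \<exists>R. covering_family C J X R \<and> (\<forall>f\<in>R. Dom C f \<in> G))"
  using assms unfolding U_site_def by blast+

text \<open>The topology of a site is determined by its sheaves with values in the universe.\<close>

lemma covering_if_sheaves_separated:
  fixes C :: "('o, 'a) cat"
  assumes U: "universe el" and site: "U_site el C J" and X: "X \<in> Obj C" and R: "R \<subseteq> arrows_to C X"
    and sep: "\<And>F s t. \<lbrakk>is_sheaf el C J F; s \<in> el (section_set F X); t \<in> el (section_set F X);
        \<And>f. f \<in> R \<Longrightarrow> restrict_along F f s = restrict_along F f t\<rbrakk> \<Longrightarrow> s = t"
  shows "covering_family C J X R"
proof -
  interpret category C by unfold_locales (rule U_site_category[OF site])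
  let ?I = "\<lparr>on_obj = \<lambda>X. X, on_arr = \<lambda>f. f\<rparr> :: ('o, 'a, 'o, 'a) ftr"
  interpret I: cat_functor C C ?I
    by unfold_locales (auto simp: is_functor_def hom_def)
  note J = U_site_topology[OF site]
  obtain G where G: "G \<subseteq> Obj C" "small el G"
    "\<And>X. X \<in> Obj C \<Longrightarrow> \<exists>R. covering_family C J X R \<and> (\<forall>f\<in>R. Dom C f \<in> G)"
    using U_site_generators[OF site] by blast
  have "cocontinuous C J C J ?I"
    unfolding cocontinuous_def
  proof (intro ballI)
    fix V S Y m assume V: "V \<in> Obj C" and S: "S \<in> J V" and m: "m \<in> hom C (on_obj ?I Y) V"
    then have "functor_pull C C ?I Y m S = pull_sieve C m S" and "m \<in> arrows_to C V" "Dom C m = Y"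
      by (auto simp: functor_pull_def pull_sieve_def hom_def arrows_to_def)
    then show "functor_pull C C ?I Y m S \<in> J Y"
      using topology_pull[OF J V S, of m] by simp
  qed
  moreover have "fully_faithful C C ?I"
    by (auto simp: fully_faithful_def bij_betw_def)
  ultimately have "sieve_generated C R \<in> J X"
  proof (rule I.covering_if_separated[OF U J J _ _ G U_site_locally_small[OF site] X
        sieve_generated_is_sieve[OF R]])
    fix F s t assume F: "is_sheaf el C J F"
      and "s \<in> el (section_set F (on_obj ?I X))" "t \<in> el (section_set F (on_obj ?I X))"
      and eq: "\<And>f. f \<in> sieve_generated C R \<Longrightarrow>
        restrict_along F (on_arr ?I f) s = restrict_along F (on_arr ?I f) t"
    then show "s = t"
      using sep[OF F, of s t] subset_sieve_generated[OF R] by auto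
  qed
  then show ?thesis using R by (simp add: covering_family_def)
qed

text \<open>A continuous functor sends covering families to covering families: a sheaf is separated along
  the image of such a family, because its composite with the functor is a sheaf.\<close>

lemma continuous_preserves_covering:
  assumes U: "universe el" and C': "is_category C'" and site: "U_site el C J"
    and u: "continuous_functor el C' J' C J u"
    and X: "X \<in> Obj C'" and R: "covering_family C' J' X R"
  shows "covering_family C J (on_obj u X) (on_arr u ` R)"
proof -
  interpret cat_functor C' C u
    using C' U_site_category[OF site] u by unfold_locales (auto simp: continuous_functor_def)
  have Ra: "f \<in> Arr C' \<and> Cod C' f = X" if "f \<in> R" for f
    using R that by (auto simp: covering_family_def arrows_to_def)
  show ?thesis
  proof (rule covering_if_sheaves_separated[OF U site])
    show "on_obj u X \<in> Obj C" using X by simp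
    show "on_arr u ` R \<subseteq> arrows_to C (on_obj u X)"
      using Ra by (auto simp: arrows_to_def)
  next
    fix F s t assume F: "is_sheaf el C J F" and s: "s \<in> el (section_set F (on_obj u X))"
      and t: "t \<in> el (section_set F (on_obj u X))"
      and eq: "\<And>f. f \<in> on_arr u ` R \<Longrightarrow> restrict_along F f s = restrict_along F f t"
    have "is_sheaf el C' J' (presheaf_comp F u)"
      using u F by (simp add: continuous_functor_def)
    then show "s = t"
      by (rule C.sheaf_separated[OF _ X R]) (use s t eq in \<open>auto simp: presheaf_comp_def\<close>)
  qed
qed

text \<open>Every object of the target is covered by objects in the image of the functor.\<close>

definition dense_functor ::
  "('o, 'a) cat \<Rightarrow> ('p, 'b) cat \<Rightarrow> ('p, 'b) topol \<Rightarrow> ('o, 'a, 'p, 'b) ftr \<Rightarrow> bool" where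
  "dense_functor C' C J u \<longleftrightarrow>
     (\<forall>V\<in>Obj C. \<exists>R. covering_family C J V R \<and> (\<forall>f\<in>R. Dom C f \<in> on_obj u ` Obj C'))"

lemma dense_functorD:
  assumes "dense_functor C' C J u" and "V \<in> Obj C"
  shows "\<exists>R. covering_family C J V R \<and> (\<forall>f\<in>R. Dom C f \<in> on_obj u ` Obj C')"
  using assms unfolding dense_functor_def by blast

text \<open>The sieves whose image generates a covering sieve.\<close>

definition image_topology ::
  "('o, 'a) cat \<Rightarrow> ('p, 'b) cat \<Rightarrow> ('p, 'b) topol \<Rightarrow> ('o, 'a, 'p, 'b) ftr \<Rightarrow> ('o, 'a) topol" where
  "image_topology C' C J u X =
     {R. is_sieve C' X R \<and> sieve_generated C (on_arr u ` R) \<in> J (on_obj u X)}"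

context cat_functor
begin

text \<open>A sieve is covering if it contains those members of a covering sieve that start from the
  image of a dense functor.\<close>

lemma dense_covering:
  assumes J: "is_topology D J" and dense: "dense_functor C D J u" and V: "V \<in> Obj D"
    and Q: "is_sieve D V Q" and S: "S \<in> J V"
    and sub: "\<And>Z m. \<lbrakk>Z \<in> Obj C; m \<in> hom D (on_obj u Z) V; m \<in> S\<rbrakk> \<Longrightarrow> m \<in> Q"
  shows "Q \<in> J V"
proof (rule topology_trans[OF J V S Q])
  fix f assume f: "f \<in> S"
  note S' = topology_sieve[OF J V S]
  have fa: "f \<in> Arr D" "Cod D f = V" using f S' by (auto simp: is_sieve_def arrows_to_def)
  obtain R where R: "covering_family D J (Dom D f) R" "\<And>z. z \<in> R \<Longrightarrow> Dom D z \<in> on_obj u ` Obj C"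
    using dense_functorD[OF dense D.Dom_Obj[OF fa(1)]] by blast
  show "pull_sieve D f Q \<in> J (Dom D f)"
  proof (rule D.covering_family_mono[OF J _ R(1)])
    show "Dom D f \<in> Obj D" using fa by simp
    show "is_sieve D (Dom D f) (pull_sieve D f Q)"
      using D.is_sieve_pull_sieve[OF Q] fa by (simp add: arrows_to_def)
    show "R \<subseteq> pull_sieve D f Q"
    proof
      fix z assume z: "z \<in> R"
      then have za: "z \<in> Arr D" "Cod D z = Dom D f"
        using R(1) by (auto simp: covering_family_def arrows_to_def)
      obtain Z where Z: "Z \<in> Obj C" "Dom D z = on_obj u Z" using R(2)[OF z] by auto
      have "Comp D f z \<in> S" using S' f za by (auto simp: is_sieve_def arrows_to_def)
      then have "Comp D f z \<in> Q"
        using sub[OF Z(1), of "Comp D f z"] Z(2) fa za by (simp add: hom_def)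
      then show "z \<in> pull_sieve D f Q"
        using za by (simp add: pull_sieve_def arrows_to_def)
    qed
  qed
qed

lemma image_arrows_to: "is_sieve C X R \<Longrightarrow> on_arr u ` R \<subseteq> arrows_to D (on_obj u X)"
  by (auto simp: is_sieve_def arrows_to_def)

lemma image_topology_is_topology:
  assumes J: "is_topology D J" and dense: "dense_functor C D J u" and ff: "fully_faithful C D u"
  shows "is_topology C (image_topology C D J u)"
proof -
  have pull: "pull_sieve C f S \<in> image_topology C D J u (Dom C f)"
    if X: "X \<in> Obj C" and S: "S \<in> image_topology C D J u X" and f: "f \<in> arrows_to C X" for X S f
  proof -
    have S': "is_sieve C X S" and cov: "sieve_generated D (on_arr u ` S) \<in> J (on_obj u X)"
      using S by (auto simp: image_topology_def)
    have fa: "f \<in> Arr C" "Cod C f = X" using f by (auto simp: arrows_to_def)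
    have Sa: "r \<in> Arr C \<and> Cod C r = X" if "r \<in> S" for r
      using S' that by (auto simp: is_sieve_def arrows_to_def)
    note sv = C.is_sieve_pull_sieve[OF S' f]
    have pulled: "pull_sieve D (on_arr u f) (sieve_generated D (on_arr u ` S)) \<in> J (on_obj u (Dom C f))"
      using topology_pull[OF J _ cov, of "on_arr u f"] X fa by (simp add: arrows_to_def)
    have "sieve_generated D (on_arr u ` pull_sieve C f S) \<in> J (on_obj u (Dom C f))"
    proof (rule dense_covering[OF J dense _ D.sieve_generated_is_sieve[OF image_arrows_to[OF sv]] pulled])
      show "on_obj u (Dom C f) \<in> Obj D" using fa by simp
      fix Z m assume Z: "Z \<in> Obj C" and m: "m \<in> hom D (on_obj u Z) (on_obj u (Dom C f))"
        and "m \<in> pull_sieve D (on_arr u f) (sieve_generated D (on_arr u ` S))"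
      then obtain r d where r: "r \<in> S" and d: "d \<in> Arr D" "Cod D d = on_obj u (Dom C r)"
        and eq: "Comp D (on_arr u f) m = Comp D (on_arr u r) d"
        using Sa by (auto simp: pull_sieve_def sieve_generated_def arrows_to_def)
      have ma: "m \<in> Arr D" "Dom D m = on_obj u Z" "Cod D m = on_obj u (Dom C f)"
        using m by (auto simp: hom_def)
      have "Dom D (Comp D (on_arr u f) m) = Dom D (Comp D (on_arr u r) d)" by (simp only: eq)
      then have "Dom D d = on_obj u Z" using ma d fa Sa[OF r] by simp
      then have "d \<in> hom D (on_obj u Z) (on_obj u (Dom C r))" using d by (simp add: hom_def)
      from full[OF ff Z _ this] obtain l where l: "l \<in> Arr C" "Dom C l = Z" "Cod C l = Dom C r"
        "on_arr u l = d" using Sa[OF r] by (auto simp: hom_def)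
      from full[OF ff Z _ m] obtain k where k: "k \<in> Arr C" "Dom C k = Z" "Cod C k = Dom C f"
        "on_arr u k = m" using fa by (auto simp: hom_def)
      have "Comp C f k = Comp C r l"
        by (rule faithful[OF ff Z X])
          (use k l fa Sa[OF r] eq in \<open>auto simp: hom_def\<close>)
      moreover have "Comp C r l \<in> S" using S' r l by (auto simp: is_sieve_def arrows_to_def)
      ultimately have "k \<in> pull_sieve C f S" using k by (simp add: pull_sieve_def arrows_to_def)
      then show "m \<in> sieve_generated D (on_arr u ` pull_sieve C f S)"
        using D.subset_sieve_generated[OF image_arrows_to[OF sv]] k(4) by blast
    qed
    then show ?thesis using sv by (simp add: image_topology_def)
  qed
  show ?thesis
    unfolding is_topology_def
  proof (intro ballI conjI allI impI)
    show "is_sieve C X S" if "S \<in> image_topology C D J u X" for X S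
      using that by (simp add: image_topology_def)
  next
    fix X assume X: "X \<in> Obj C"
    have id: "Idt D (on_obj u X) \<in> on_arr u ` arrows_to C X"
      using X by (auto simp: arrows_to_def intro!: image_eqI[of _ _ "Idt C X"])
    have "arrows_to D (on_obj u X) \<subseteq> sieve_generated D (on_arr u ` arrows_to C X)"
    proof
      fix d assume d: "d \<in> arrows_to D (on_obj u X)"
      then have "d = Comp D (Idt D (on_obj u X)) d"
        and "d \<in> arrows_to D (Dom D (Idt D (on_obj u X)))"
        using X by (auto simp: arrows_to_def)
      then show "d \<in> sieve_generated D (on_arr u ` arrows_to C X)"
        using id unfolding sieve_generated_def by blast
    qed
    then have "sieve_generated D (on_arr u ` arrows_to C X) \<in> J (on_obj u X)"
      using D.topology_mono[OF J _ topology_max[OF J]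
          D.sieve_generated_is_sieve[OF image_arrows_to[OF C.is_sieve_arrows_to]]] X by simp
    then show "arrows_to C X \<in> image_topology C D J u X"
      using C.is_sieve_arrows_to by (simp add: image_topology_def)
  next
    show "pull_sieve C f S \<in> image_topology C D J u (Dom C f)"
      if "X \<in> Obj C" "S \<in> image_topology C D J u X" "f \<in> arrows_to C X" for X S f
      using that by (rule pull)
  next
    fix X S R assume X: "X \<in> Obj C" and S: "S \<in> image_topology C D J u X" and R: "is_sieve C X R"
      and loc: "\<forall>f\<in>S. pull_sieve C f R \<in> image_topology C D J u (Dom C f)"
    have S': "is_sieve C X S" using S by (simp add: image_topology_def)
    have Ra: "r \<in> Arr C \<and> Cod C r = X" if "r \<in> R" for r
      using R that by (auto simp: is_sieve_def arrows_to_def)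
    have Sa: "r \<in> Arr C \<and> Cod C r = X" if "r \<in> S" for r
      using S' that by (auto simp: is_sieve_def arrows_to_def)
    note sv = D.sieve_generated_is_sieve[OF image_arrows_to[OF R]]
    have cov: "covering_family D J (on_obj u X) (on_arr u ` S)"
      using S image_arrows_to by (simp add: image_topology_def covering_family_def)
    have "sieve_generated D (on_arr u ` R) \<in> J (on_obj u X)"
    proof (rule D.topology_trans_family[OF J _ cov sv])
      show "on_obj u X \<in> Obj D" using X by simp
      fix n assume "n \<in> on_arr u ` S"
      then obtain f where f: "f \<in> S" and n: "n = on_arr u f" by auto
      have "sieve_generated D (on_arr u ` pull_sieve C f R) \<in> J (on_obj u (Dom C f))"
        using loc f by (simp add: image_topology_def)
      moreover have "is_sieve D (on_obj u (Dom C f)) (pull_sieve D n (sieve_generated D (on_arr u ` R)))"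
        using D.is_sieve_pull_sieve[OF sv, of n] Sa[OF f] by (simp add: n arrows_to_def)
      moreover have "sieve_generated D (on_arr u ` pull_sieve C f R) \<subseteq>
          pull_sieve D n (sieve_generated D (on_arr u ` R))"
      proof (rule D.sieve_generated_least)
        show "is_sieve D (on_obj u (Dom C f)) (pull_sieve D n (sieve_generated D (on_arr u ` R)))" by fact
        show "on_arr u ` pull_sieve C f R \<subseteq> pull_sieve D n (sieve_generated D (on_arr u ` R))"
        proof clarify
          fix g assume "g \<in> pull_sieve C f R"
          then have g: "g \<in> Arr C" "Cod C g = Dom C f" and "Comp C f g \<in> R"
            by (auto simp: pull_sieve_def arrows_to_def)
          then have "on_arr u (Comp C f g) \<in> sieve_generated D (on_arr u ` R)"
            using D.subset_sieve_generated[OF image_arrows_to[OF R]] by blast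
          then show "on_arr u g \<in> pull_sieve D n (sieve_generated D (on_arr u ` R))"
            using g Sa[OF f] by (simp add: n pull_sieve_def arrows_to_def)
        qed
      qed
      ultimately show "pull_sieve D n (sieve_generated D (on_arr u ` R)) \<in> J (Dom D n)"
        using D.topology_mono[OF J] Sa[OF f] by (simp add: n)
    qed
    then show "R \<in> image_topology C D J u X" using R by (simp add: image_topology_def)
  qed
qed

text \<open>A matching family on a sieve \<open>R\<close> extends to the sieve generated by the image of \<open>R\<close>; the
  extension is well defined because a sheaf is separated for the covers by objects of the image,
  where two factorizations can be compared by full faithfulness.\<close>

lemma image_topology_continuous:
  assumes J: "is_topology D J" and dense: "dense_functor C D J u" and ff: "fully_faithful C D u"
  shows "continuous_functor el C (image_topology C D J u) D J u"
  unfolding continuous_functor_def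
proof (intro conjI allI impI)
  show "is_functor C D u" by (rule is_functor)
next
  fix F assume F: "is_sheaf el D J F"
  note P = sheaf_presheaf[OF F]
  let ?res = "restrict_along F"
  have sel: "section_set (presheaf_comp F u) X = section_set F (on_obj u X)"
    "restrict_along (presheaf_comp F u) f = ?res (on_arr u f)" for X f
    by (simp_all add: presheaf_comp_def)
  have "is_presheaf el C (presheaf_comp F u)"
    unfolding is_presheaf_def sel
  proof (intro conjI ballI impI)
    show "?res (on_arr u f) s \<in> el (section_set F (on_obj u (Dom C f)))"
      if "f \<in> Arr C" "s \<in> el (section_set F (on_obj u (Cod C f)))" for f s
      using restrict_in[OF P, of "on_arr u f" s] that by simp
    show "?res (on_arr u (Idt C X)) s = s" if "X \<in> Obj C" "s \<in> el (section_set F (on_obj u X))" for X s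
      using restrict_Idt[OF P, of "on_obj u X" s] that by simp
    show "?res (on_arr u (Comp C g f)) s = ?res (on_arr u f) (?res (on_arr u g) s)"
      if "f \<in> Arr C" "g \<in> Arr C" "Cod C f = Dom C g" "s \<in> el (section_set F (on_obj u (Cod C g)))" for f g s
      using restrict_Comp[OF P, of "on_arr u f" "on_arr u g" s] that by simp
  qed
  moreover have "\<exists>!s. s \<in> el (section_set F (on_obj u X)) \<and> (\<forall>f\<in>R. ?res (on_arr u f) s = t f)"
    if X: "X \<in> Obj C" and R: "R \<in> image_topology C D J u X"
      and t: "matching_family el C (presheaf_comp F u) R t" for X R t
  proof -
    have R': "is_sieve C X R" and cov: "sieve_generated D (on_arr u ` R) \<in> J (on_obj u X)"
      using R by (auto simp: image_topology_def)
    let ?S = "sieve_generated D (on_arr u ` R)"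
    have Ra: "r \<in> Arr C \<and> Cod C r = X" if "r \<in> R" for r
      using R' that by (auto simp: is_sieve_def arrows_to_def)
    have uX: "on_obj u X \<in> Obj D" using X by simp
    have t_in: "t r \<in> el (section_set F (on_obj u (Dom C r)))" if "r \<in> R" for r
      using t that by (simp add: matching_family_def sel)
    have t_comp: "t (Comp C r g) = ?res (on_arr u g) (t r)"
      if "r \<in> R" "g \<in> Arr C" "Cod C g = Dom C r" for r g
      using t that by (simp add: matching_family_def sel arrows_to_def)
    have res_t_in: "?res d (t r) \<in> el (section_set F (Dom D d))"
      if "r \<in> R" "d \<in> Arr D" "Cod D d = on_obj u (Dom C r)" for r d
      using restrict_in[OF P, of d "t r"] t_in that by simp
    have wd: "?res d (t r) = ?res d' (t r')"
      if r: "r \<in> R" "d \<in> Arr D" "Cod D d = on_obj u (Dom C r)"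
        and r': "r' \<in> R" "d' \<in> Arr D" "Cod D d' = on_obj u (Dom C r')"
        and eq: "Comp D (on_arr u r) d = Comp D (on_arr u r') d'" for r d r' d'
    proof -
      have "Dom D (Comp D (on_arr u r) d) = Dom D (Comp D (on_arr u r') d')" by (simp only: eq)
      then have dd: "Dom D d' = Dom D d" using r r' Ra by simp
      obtain Q where Q: "covering_family D J (Dom D d) Q"
        "\<And>z. z \<in> Q \<Longrightarrow> Dom D z \<in> on_obj u ` Obj C"
        using dense_functorD[OF dense D.Dom_Obj[OF r(2)]] by blast
      show ?thesis
      proof (rule D.sheaf_separated[OF F _ Q(1)])
        show "Dom D d \<in> Obj D" using r by simp
        show "?res d (t r) \<in> el (section_set F (Dom D d))" by (rule res_t_in[OF r])
        show "?res d' (t r') \<in> el (section_set F (Dom D d))" using res_t_in[OF r'] by (simp add: dd)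
      next
        fix z assume z: "z \<in> Q"
        then have za: "z \<in> Arr D" "Cod D z = Dom D d"
          using Q(1) by (auto simp: covering_family_def arrows_to_def)
        obtain Z where Z: "Z \<in> Obj C" "Dom D z = on_obj u Z" using Q(2)[OF z] by auto
        have h: "Comp D d z \<in> hom D (on_obj u Z) (on_obj u (Dom C r))"
          "Comp D d' z \<in> hom D (on_obj u Z) (on_obj u (Dom C r'))"
          using r r' za Z dd by (auto simp: hom_def)
        obtain l where l: "l \<in> Arr C" "Dom C l = Z" "Cod C l = Dom C r" "on_arr u l = Comp D d z"
          using full[OF ff Z(1) _ h(1)] Ra[OF r(1)] by (auto simp: hom_def)
        obtain l' where l': "l' \<in> Arr C" "Dom C l' = Z" "Cod C l' = Dom C r'" "on_arr u l' = Comp D d' z"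
          using full[OF ff Z(1) _ h(2)] Ra[OF r'(1)] by (auto simp: hom_def)
        have "Comp D (on_arr u r) (Comp D d z) = Comp D (Comp D (on_arr u r) d) z"
          using r za Ra[OF r(1)] by simp
        also have "\<dots> = Comp D (on_arr u r') (Comp D d' z)"
          unfolding eq using r' za Ra[OF r'(1)] dd by simp
        finally have "Comp C r l = Comp C r' l'"
          using l l' Ra[OF r(1)] Ra[OF r'(1)] by (intro faithful[OF ff Z(1) X]) (auto simp: hom_def)
        then have "?res (Comp D d z) (t r) = ?res (Comp D d' z) (t r')"
          using t_comp[OF r(1), of l] t_comp[OF r'(1), of l'] l l' by simp
        then show "?res z (?res d (t r)) = ?res z (?res d' (t r'))"
          using restrict_Comp[OF P, of z d "t r"] restrict_Comp[OF P, of z d' "t r'"]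
            za r r' dd t_in by simp
      qed
    qed
    \<comment> \<open>The extension of \<open>t\<close> to the sieve generated by the image of \<open>R\<close>.\<close>
    define \<tau> where "\<tau> n = (SOME v. \<exists>r d. r \<in> R \<and> d \<in> Arr D \<and> Cod D d = on_obj u (Dom C r) \<and>
      n = Comp D (on_arr u r) d \<and> v = ?res d (t r))" for n
    have \<tau>: "\<tau> (Comp D (on_arr u r) d) = ?res d (t r)"
      if r: "r \<in> R" "d \<in> Arr D" "Cod D d = on_obj u (Dom C r)" for r d
      unfolding \<tau>_def
    proof (rule some_equality)
      show "\<exists>r' d'. r' \<in> R \<and> d' \<in> Arr D \<and> Cod D d' = on_obj u (Dom C r') \<and>
          Comp D (on_arr u r) d = Comp D (on_arr u r') d' \<and> ?res d (t r) = ?res d' (t r')"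
        using r by blast
    next
      fix v assume "\<exists>r' d'. r' \<in> R \<and> d' \<in> Arr D \<and> Cod D d' = on_obj u (Dom C r') \<and>
          Comp D (on_arr u r) d = Comp D (on_arr u r') d' \<and> v = ?res d' (t r')"
      then show "v = ?res d (t r)" using wd[OF r] by force
    qed
    have \<tau>_id: "\<tau> (on_arr u r) = t r" if "r \<in> R" for r
      using \<tau>[OF that, of "Idt D (on_obj u (Dom C r))"] Ra[OF that] t_in[OF that]
        restrict_Idt[OF P, of "on_obj u (Dom C r)"] by simp
    have S_cases: "\<exists>r d. r \<in> R \<and> d \<in> Arr D \<and> Cod D d = on_obj u (Dom C r) \<and> n = Comp D (on_arr u r) d"
      if "n \<in> ?S" for n
      using that Ra by (force simp: sieve_generated_def arrows_to_def)
    have "matching_family el D F ?S \<tau>"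
      unfolding matching_family_def
    proof (intro ballI conjI)
      fix n assume "n \<in> ?S"
      then obtain r d where r: "r \<in> R" "d \<in> Arr D" "Cod D d = on_obj u (Dom C r)"
        and n: "n = Comp D (on_arr u r) d" using S_cases by blast
      show "\<tau> n \<in> el (section_set F (Dom D n))"
        using res_t_in[OF r] r Ra[OF r(1)] \<tau>[OF r] by (simp add: n)
      fix g assume "g \<in> arrows_to D (Dom D n)"
      then have g: "g \<in> Arr D" "Cod D g = Dom D d" using r Ra[OF r(1)] by (auto simp: n arrows_to_def)
      have "Comp D n g = Comp D (on_arr u r) (Comp D d g)"
        using r g Ra[OF r(1)] by (simp add: n)
      then show "\<tau> (Comp D n g) = ?res g (\<tau> n)"
        using \<tau>[OF r(1), of "Comp D d g"] \<tau>[OF r] g r restrict_Comp[OF P, of g d "t r"] t_in[OF r(1)]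
        by (simp add: n)
    qed
    from sheaf_glue[OF F uX cov this]
    obtain s where s: "s \<in> el (section_set F (on_obj u X))" "\<And>f. f \<in> ?S \<Longrightarrow> ?res f s = \<tau> f"
      by blast
    have sub: "on_arr u r \<in> ?S" if "r \<in> R" for r
      using D.subset_sieve_generated[OF image_arrows_to[OF R']] that by blast
    have cov': "covering_family D J (on_obj u X) (on_arr u ` R)"
      using cov image_arrows_to[OF R'] by (simp add: covering_family_def)
    show ?thesis
    proof (rule ex1I[of _ s])
      show "s \<in> el (section_set F (on_obj u X)) \<and> (\<forall>f\<in>R. ?res (on_arr u f) s = t f)"
        using s sub \<tau>_id by simp
      show "s' = s" if "s' \<in> el (section_set F (on_obj u X)) \<and> (\<forall>f\<in>R. ?res (on_arr u f) s' = t f)" for s'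
        by (rule D.sheaf_separated[OF F uX cov']) (use that s sub \<tau>_id in auto)
    qed
  qed
  ultimately show "is_sheaf el C (image_topology C D J u) (presheaf_comp F u)"
    unfolding is_sheaf_def sel by blast
qed

end

section \<open>Cocontinuity\<close>

context cat_functor
begin

lemma functor_pull_is_sieve:
  assumes "is_sieve D V S" and "m \<in> hom D (on_obj u Y) V"
  shows "is_sieve C Y (functor_pull C D u Y m S)"
  unfolding is_sieve_def
proof (intro conjI ballI)
  show "functor_pull C D u Y m S \<subseteq> arrows_to C Y" by (auto simp: functor_pull_def)
next
  fix f g assume f: "f \<in> functor_pull C D u Y m S" and g: "g \<in> arrows_to C (Dom C f)"
  then have fa: "f \<in> Arr C" "Cod C f = Y" "g \<in> Arr C" "Cod C g = Dom C f"
    and "Comp D m (on_arr u f) \<in> S"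
    by (auto simp: functor_pull_def arrows_to_def)
  then have "Comp D (Comp D m (on_arr u f)) (on_arr u g) \<in> S"
    using assms by (auto simp: is_sieve_def hom_def arrows_to_def)
  then show "Comp C f g \<in> functor_pull C D u Y m S"
    using fa assms(2) by (simp add: functor_pull_def hom_def arrows_to_def)
qed

text \<open>The sieves all of whose preimages are covering form a topology, so cocontinuity can be
  checked on generators.\<close>

lemma cocontinuous_generated:
  assumes J: "is_topology C J"
    and G: "\<And>V R. \<lbrakk>V \<in> Obj D; G V R\<rbrakk> \<Longrightarrow> R \<subseteq> arrows_to D V"
    and gen: "\<And>V R Y m. \<lbrakk>V \<in> Obj D; G V R; Y \<in> Obj C; m \<in> hom D (on_obj u Y) V\<rbrakk> \<Longrightarrow>
      functor_pull C D u Y m (sieve_generated D R) \<in> J Y"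
  shows "cocontinuous C J D (generated_topology D G) u"
proof -
  let ?pull = "functor_pull C D u"
  define K where "K V = {R. is_sieve D V R \<and>
    (\<forall>Y\<in>Obj C. \<forall>m\<in>hom D (on_obj u Y) V. ?pull Y m R \<in> J Y)}" for V
  have K_pull: "?pull Y m R \<in> J Y" if "R \<in> K V" "Y \<in> Obj C" "m \<in> hom D (on_obj u Y) V" for V R Y m
    using that by (simp add: K_def)
  have K_sieve: "is_sieve D V R" if "R \<in> K V" for V R
    using that by (simp add: K_def)
  have "is_topology D K"
    unfolding is_topology_def
  proof (intro ballI conjI allI impI)
    show "is_sieve D V S" if "S \<in> K V" for V S using that by (rule K_sieve)
  next
    fix V assume "V \<in> Obj D"
    have "?pull Y m (arrows_to D V) = arrows_to C Y" if "m \<in> hom D (on_obj u Y) V" for Y m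
      using that by (auto simp: functor_pull_def hom_def arrows_to_def)
    then show "arrows_to D V \<in> K V"
      using topology_max[OF J] D.is_sieve_arrows_to by (simp add: K_def)
  next
    fix V S f assume "V \<in> Obj D" and S: "S \<in> K V" and f: "f \<in> arrows_to D V"
    have "?pull Y m (pull_sieve D f S) \<in> J Y" if Y: "Y \<in> Obj C" and m: "m \<in> hom D (on_obj u Y) (Dom D f)" for Y m
    proof -
      have "?pull Y m (pull_sieve D f S) = ?pull Y (Comp D f m) S"
        using m f by (auto simp: functor_pull_def pull_sieve_def hom_def arrows_to_def)
      moreover have "Comp D f m \<in> hom D (on_obj u Y) V"
        using m f by (auto simp: hom_def arrows_to_def)
      ultimately show ?thesis using K_pull[OF S Y] by simp
    qed
    then show "pull_sieve D f S \<in> K (Dom D f)"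
      using D.is_sieve_pull_sieve[OF K_sieve[OF S] f] by (simp add: K_def)
  next
    fix V S R assume V: "V \<in> Obj D" and S: "S \<in> K V" and R: "is_sieve D V R"
      and loc: "\<forall>f\<in>S. pull_sieve D f R \<in> K (Dom D f)"
    have "?pull Y m R \<in> J Y" if Y: "Y \<in> Obj C" and m: "m \<in> hom D (on_obj u Y) V" for Y m
    proof (rule topology_trans[OF J Y K_pull[OF S Y m] functor_pull_is_sieve[OF R m]])
      fix g assume "g \<in> ?pull Y m S"
      then have g: "g \<in> Arr C" "Cod C g = Y" and n: "Comp D m (on_arr u g) \<in> S"
        by (auto simp: functor_pull_def arrows_to_def)
      have ma: "m \<in> Arr D" "Dom D m = on_obj u Y" "Cod D m = V" using m by (auto simp: hom_def)
      have "?pull (Dom C g) (Idt D (on_obj u (Dom C g))) (pull_sieve D (Comp D m (on_arr u g)) R) \<in> J (Dom C g)"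
        by (rule K_pull[OF bspec[OF loc n]]) (use g ma in \<open>simp_all add: hom_def\<close>)
      moreover have "?pull (Dom C g) (Idt D (on_obj u (Dom C g))) (pull_sieve D (Comp D m (on_arr u g)) R)
          = pull_sieve C g (?pull Y m R)"
        using g ma by (auto simp: functor_pull_def pull_sieve_def arrows_to_def)
      ultimately show "pull_sieve C g (?pull Y m R) \<in> J (Dom C g)" by simp
    qed
    then show "R \<in> K V" using R by (simp add: K_def)
  qed
  moreover have "covering_family D K V R" if "V \<in> Obj D" "G V R" for V R
    using D.sieve_generated_is_sieve[OF G[OF that]] gen[OF that] G[OF that]
    by (simp add: covering_family_def K_def)
  ultimately have "generated_topology D G V \<subseteq> K V" for V
    by (rule generated_topology_least)
  then show ?thesis
    unfolding cocontinuous_def using K_pull by blast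
qed

text \<open>By fullness, a member of the pullback of a covering sieve that starts from the image of an object
  comes from the preimage of the sieve; by density, these members generate a covering sieve.\<close>

lemma image_topology_cocontinuous:
  assumes J: "is_topology D J" and dense: "dense_functor C D J u" and ff: "fully_faithful C D u"
  shows "cocontinuous C (image_topology C D J u) D J u"
  unfolding cocontinuous_def
proof (intro ballI)
  fix V S Y m assume V: "V \<in> Obj D" and S: "S \<in> J V" and Y: "Y \<in> Obj C"
    and m: "m \<in> hom D (on_obj u Y) V"
  note sv = functor_pull_is_sieve[OF topology_sieve[OF J V S] m]
  have m': "m \<in> arrows_to D V" "Dom D m = on_obj u Y" using m by (auto simp: hom_def arrows_to_def)
  have pulled: "pull_sieve D m S \<in> J (on_obj u Y)"
    using topology_pull[OF J V S m'(1)] m'(2) by simp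
  have "sieve_generated D (on_arr u ` functor_pull C D u Y m S) \<in> J (on_obj u Y)"
  proof (rule dense_covering[OF J dense _ D.sieve_generated_is_sieve[OF image_arrows_to[OF sv]] pulled])
    show "on_obj u Y \<in> Obj D" using Y by simp
    fix Z n assume Z: "Z \<in> Obj C" and n: "n \<in> hom D (on_obj u Z) (on_obj u Y)" and "n \<in> pull_sieve D m S"
    then have "Comp D m n \<in> S" by (simp add: pull_sieve_def)
    obtain k where k: "k \<in> hom C Z Y" "on_arr u k = n" using full[OF ff Z Y n] by blast
    have "k \<in> functor_pull C D u Y m S"
      using k \<open>Comp D m n \<in> S\<close> by (simp add: functor_pull_def hom_def arrows_to_def)
    then show "n \<in> sieve_generated D (on_arr u ` functor_pull C D u Y m S)"
      using D.subset_sieve_generated[OF image_arrows_to[OF sv]] k(2) by blast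
  qed
  then show "functor_pull C D u Y m S \<in> image_topology C D J u Y"
    using sv by (simp add: image_topology_def)
qed

end

section \<open>Fibred categories\<close>

lemma fibre_sel [simp]:
  "Obj (fibre S i) = {V \<in> Obj (total_cat S). on_obj (proj S) V = i}"
  "Arr (fibre S i) = {m \<in> Arr (total_cat S). on_obj (proj S) (Dom (total_cat S) m) = i \<and>
     on_obj (proj S) (Cod (total_cat S) m) = i \<and> on_arr (proj S) m = Idt (base S) i}"
  "Dom (fibre S i) = Dom (total_cat S)" "Cod (fibre S i) = Cod (total_cat S)"
  "Idt (fibre S i) = Idt (total_cat S)" "Comp (fibre S i) = Comp (total_cat S)"
  by (simp_all add: fibre_def)

lemma fibre_is_category:
  assumes "is_category (total_cat S)" and "is_category (base S)"
    and "is_functor (total_cat S) (base S) (proj S)" and i: "i \<in> Obj (base S)"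
  shows "is_category (fibre S i)"
proof -
  interpret cat_functor "total_cat S" "base S" "proj S"
    by unfold_locales (use assms in auto)
  show ?thesis
    unfolding is_category_def hom_def using i by (simp add: D.Comp_Idt_left[OF D.Idt_Arr])
qed

lemma coevanescent_generator_subset:
  "vertical_covering S V R \<or> cartesian_covering S V R \<Longrightarrow> R \<subseteq> arrows_to (total_cat S) V"
  by (auto simp: vertical_covering_def cartesian_covering_def covering_family_def arrows_to_def)

lemma coevanescent_is_topology:
  assumes "is_category (total_cat S)"
  shows "is_topology (total_cat S) (coevanescent_topology S)"
proof -
  interpret category "total_cat S" by unfold_locales (rule assms)
  show ?thesis
    unfolding coevanescent_topology_def
    by (rule generated_topology_is_topology) (rule coevanescent_generator_subset)
qed

lemma coevanescent_covering:
  assumes "is_category (total_cat S)" and "V \<in> Obj (total_cat S)"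
    and "vertical_covering S V R \<or> cartesian_covering S V R"
  shows "covering_family (total_cat S) (coevanescent_topology S) V R"
proof -
  interpret category "total_cat S" by unfold_locales (rule assms)
  show ?thesis
    unfolding coevanescent_topology_def
    by (rule generated_topology_covering[OF assms(2)])
      (rule assms(3), rule coevanescent_generator_subset[OF assms(3)])
qed

text \<open>A fibred category with a normalized cleavage, without topologies.\<close>

locale cleaved_category =
  fixes S :: "('i, 'a, 'e, 'm) fsite"
  assumes fibred: "is_fibred S" and normalized: "is_normalized_cleavage S"
begin

text \<open>The total category, the base, and the projection on objects and on arrows.\<close>

abbreviation "E \<equiv> total_cat S"
abbreviation "B \<equiv> base S"
abbreviation "po \<equiv> on_obj (proj S)"
abbreviation "pa \<equiv> on_arr (proj S)"

sublocale P: cat_functor E B "proj S"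
  by unfold_locales (use fibred in \<open>simp_all add: is_fibred_def\<close>)

lemma cleavage_props:
  assumes "f \<in> Arr B" and "V \<in> Obj E" and "po V = Cod B f"
  shows cleavage_Arr: "cleavage S f V \<in> Arr E" and Cod_cleavage: "Cod E (cleavage S f V) = V"
    and proj_cleavage: "pa (cleavage S f V) = f" and cleavage_cartesian: "is_cartesian S (cleavage S f V)"
    and proj_Dom_cleavage: "po (Dom E (cleavage S f V)) = Dom B f"
proof -
  have V: "V \<in> Obj (fibre S (Cod B f))" using assms by simp
  have H: "cleavage S f V \<in> arrows_to E V \<and> is_cartesian S (cleavage S f V) \<and> pa (cleavage S f V) = f"
    using bspec[OF bspec[OF conjunct1[OF normalized[unfolded is_normalized_cleavage_def]] assms(1)] V] .
  then show a: "cleavage S f V \<in> Arr E" and "Cod E (cleavage S f V) = V"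
    and f: "pa (cleavage S f V) = f" and "is_cartesian S (cleavage S f V)"
    by (auto simp: arrows_to_def)
  show "po (Dom E (cleavage S f V)) = Dom B f"
    using P.functor_Dom[OF a] by (simp add: f)
qed

lemma cartesian_factorization:
  assumes "is_cartesian S m" and "n \<in> Arr E" and "Cod E n = Cod E m" and "pa n = pa m"
  shows "\<exists>!h. h \<in> hom (fibre S (po (Dom E m))) (Dom E n) (Dom E m) \<and> Comp E m h = n"
  using assms unfolding is_cartesian_def by blast

lemma cleavage_vertical_factorization:
  assumes f: "f \<in> Arr B" and V: "V \<in> Obj E" "po V = Cod B f"
    and n: "n \<in> Arr E" "Cod E n = V" "pa n = f"
  shows "\<exists>h. h \<in> hom (fibre S (Dom B f)) (Dom E n) (Dom E (cleavage S f V)) \<and> Comp E (cleavage S f V) h = n"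
  using cartesian_factorization[OF cleavage_cartesian[OF f V] n(1)] n(2,3)
  by (auto simp: Cod_cleavage[OF f V] proj_cleavage[OF f V] proj_Dom_cleavage[OF f V])

text \<open>In a fibred category the canonical arrows have the stronger lifting property, for arrows whose
  projection only factors through \<open>f\<close>, because cartesian arrows compose.\<close>

lemma cleavage_factorization:
  assumes f: "f \<in> Arr B" and V: "V \<in> Obj E" "po V = Cod B f"
    and n: "n \<in> Arr E" "Cod E n = V"
    and k: "k \<in> Arr B" "Cod B k = Dom B f" "pa n = Comp B f k"
  shows "\<exists>d. d \<in> Arr E \<and> Dom E d = Dom E n \<and> Cod E d = Dom E (cleavage S f V) \<and>
    Comp E (cleavage S f V) d = n"
proof -
  let ?c = "cleavage S f V" let ?c' = "cleavage S k (Dom E (cleavage S f V))"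
  note c = cleavage_props[OF f V]
  have W: "Dom E ?c \<in> Obj E" "po (Dom E ?c) = Cod B k" using c k by simp_all
  note c' = cleavage_props[OF k(1) W]
  have comp: "is_cartesian S (Comp E ?c ?c')"
    using fibred c(4) c'(4) c'(2) unfolding is_fibred_def by blast
  have "pa n = pa (Comp E ?c ?c')" and "Cod E n = Cod E (Comp E ?c ?c')"
    and dom: "Dom E (Comp E ?c ?c') = Dom E ?c'"
    using c c' k n by simp_all
  then obtain h where h: "h \<in> hom (fibre S (po (Dom E ?c'))) (Dom E n) (Dom E ?c')"
    and eq: "Comp E (Comp E ?c ?c') h = n"
    using cartesian_factorization[OF comp n(1)] by auto
  have ha: "h \<in> Arr E" "Dom E h = Dom E n" "Cod E h = Dom E ?c'" using h by (auto simp: hom_def)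
  have "Comp E ?c (Comp E ?c' h) = n" using eq c c' ha by simp
  moreover have "Comp E ?c' h \<in> Arr E" "Dom E (Comp E ?c' h) = Dom E n"
    "Cod E (Comp E ?c' h) = Dom E ?c"
    using c c' ha by simp_all
  ultimately show ?thesis by blast
qed

lemma inv_image_square:
  assumes f: "f \<in> Arr B" and r: "r \<in> Arr (fibre S (Cod B f))"
  shows "on_arr (inv_image S f) r \<in> hom (fibre S (Dom B f))
      (Dom E (cleavage S f (Dom E r))) (Dom E (cleavage S f (Cod E r)))"
    and "Comp E (cleavage S f (Cod E r)) (on_arr (inv_image S f) r) = Comp E r (cleavage S f (Dom E r))"
proof -
  have ra: "r \<in> Arr E" "po (Dom E r) = Cod B f" "po (Cod E r) = Cod B f" "pa r = Idt B (Cod B f)"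
    using r by simp_all
  have W: "Dom E r \<in> Obj E" "Cod E r \<in> Obj E" using ra by simp_all
  note cW = cleavage_props[OF f W(1) ra(2)] and cV = cleavage_props[OF f W(2) ra(3)]
  let ?n = "Comp E r (cleavage S f (Dom E r))"
  have n: "?n \<in> Arr E" "Dom E ?n = Dom E (cleavage S f (Dom E r))"
    "Cod E ?n = Cod E (cleavage S f (Cod E r))" "pa ?n = pa (cleavage S f (Cod E r))"
    using cW cV ra f by simp_all
  have "\<exists>!h. h \<in> hom (fibre S (Dom B f)) (Dom E (cleavage S f (Dom E r)))
      (Dom E (cleavage S f (Cod E r))) \<and> Comp E (cleavage S f (Cod E r)) h = ?n"
    using cartesian_factorization[OF cV(4) n(1,3,4)] unfolding n(2) cV(5) .
  from theI'[OF this]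
  show "on_arr (inv_image S f) r \<in> hom (fibre S (Dom B f))
      (Dom E (cleavage S f (Dom E r))) (Dom E (cleavage S f (Cod E r)))"
    and "Comp E (cleavage S f (Cod E r)) (on_arr (inv_image S f) r) = ?n"
    by (simp_all add: inv_image_def)
qed

text \<open>An arrow is determined by its projection and by its vertical part.\<close>

lemma total_locally_small:
  assumes U: "universe el" and B: "locally_small el B"
    and fib: "\<And>i. i \<in> Obj B \<Longrightarrow> locally_small el (fibre S i)"
  shows "locally_small el E"
  unfolding locally_small_def
proof (intro ballI)
  fix W V assume W: "W \<in> Obj E" and V: "V \<in> Obj E"
  let ?H = "\<lambda>f. Comp E (cleavage S f V) ` hom (fibre S (Dom B f)) W (Dom E (cleavage S f V))"
  have "small el (\<Union>f\<in>hom B (po W) (po V). ?H f)"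
  proof (rule small_UN[OF U])
    show "small el (hom B (po W) (po V))" using B W V by (simp add: locally_small_def)
    fix f assume "f \<in> hom B (po W) (po V)"
    then have f: "f \<in> Arr B" "Dom B f = po W" "po V = Cod B f" by (auto simp: hom_def)
    note c = cleavage_props[OF f(1) V f(3)]
    have "locally_small el (fibre S (Dom B f))" using fib f(1) by simp
    then have "small el (hom (fibre S (Dom B f)) W (Dom E (cleavage S f V)))"
      unfolding locally_small_def using W f c by simp
    then show "small el (?H f)" by (rule small_image[OF U])
  qed
  moreover have "hom E W V \<subseteq> (\<Union>f\<in>hom B (po W) (po V). ?H f)"
  proof
    fix m assume "m \<in> hom E W V"
    then have m: "m \<in> Arr E" "Dom E m = W" "Cod E m = V" by (auto simp: hom_def)
    have pm: "pa m \<in> Arr B" "po V = Cod B (pa m)" using m by simp_all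
    obtain h where h: "h \<in> hom (fibre S (Dom B (pa m))) W (Dom E (cleavage S (pa m) V))"
      and eq: "Comp E (cleavage S (pa m) V) h = m"
      using cleavage_vertical_factorization[OF pm(1) V pm(2) m(1,3) refl] m(2) by blast
    have "m \<in> ?H (pa m)" using imageI[OF h, of "Comp E (cleavage S (pa m) V)"] by (simp only: eq)
    moreover have "pa m \<in> hom B (po W) (po V)" using m by (simp add: hom_def)
    ultimately show "m \<in> (\<Union>f\<in>hom B (po W) (po V). ?H f)" by blast
  qed
  ultimately show "small el (hom E W V)" by (rule small_subset[OF U])
qed

end

section \<open>Base change\<close>

text \<open>The base change of a cleaved fibred category along a fully faithful functor.  The
  topology \<open>JI'\<close> is only carried along.\<close>

locale base_changed = cleaved_category S + \<Phi>: cat_functor I' "base S" \<phi>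
  for S :: "('i, 'a, 'e, 'm) fsite" and I' :: "('j, 'b) cat" and \<phi> :: "('j, 'b, 'i, 'a) ftr" +
  fixes JI' :: "('j, 'b) topol"
  assumes full_faith: "fully_faithful I' (base S) \<phi>"
begin

abbreviation "S' \<equiv> base_change S I' JI' \<phi>"
abbreviation "E' \<equiv> total_cat S'"

lemma base_change_sel [simp]:
  "base S' = I'" "base_top S' = JI'"
  "on_obj (proj S') = fst" "on_arr (proj S') = fst"
  "cleavage S' f (i, V) = (f, cleavage S (on_arr \<phi> f) V)"
  "fib_top S' i (i', V) = (\<lambda>R. Pair (Idt I' i) ` R) ` fib_top S (on_obj \<phi> i) V"
  by (simp_all add: base_change_def)

lemma total_Obj [simp]: "(i, V) \<in> Obj E' \<longleftrightarrow> i \<in> Obj I' \<and> V \<in> Obj E \<and> on_obj \<phi> i = po V"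
  by (simp add: base_change_def)

lemma total_Arr [simp]: "(f, m) \<in> Arr E' \<longleftrightarrow> f \<in> Arr I' \<and> m \<in> Arr E \<and>
    on_obj \<phi> (Dom I' f) = po (Dom E m) \<and> on_obj \<phi> (Cod I' f) = po (Cod E m) \<and> on_arr \<phi> f = pa m"
  by (auto simp: base_change_def)

lemma total_sel [simp]:
  "Dom E' (f, m) = (Dom I' f, Dom E m)" "Cod E' (f, m) = (Cod I' f, Cod E m)"
  "Idt E' (i, V) = (Idt I' i, Idt E V)"
  "Comp E' (g, n) (f, m) = (Comp I' g f, Comp E n m)"
  by (simp_all add: base_change_def)

lemma total_is_category: "is_category E'"
  unfolding is_category_def
proof (intro conjI)
  show "\<forall>f\<in>Arr E'. Dom E' f \<in> Obj E' \<and> Cod E' f \<in> Obj E'" by clarsimp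
  show "\<forall>X\<in>Obj E'. Idt E' X \<in> hom E' X X" by (clarsimp simp: hom_def)
  show "\<forall>f\<in>Arr E'. \<forall>g\<in>Arr E'. Cod E' f = Dom E' g \<longrightarrow> Comp E' g f \<in> hom E' (Dom E' f) (Cod E' g)"
    by (clarsimp simp: hom_def)
  show "\<forall>f\<in>Arr E'. Comp E' f (Idt E' (Dom E' f)) = f \<and> Comp E' (Idt E' (Cod E' f)) f = f"
    by clarsimp
  show "\<forall>f\<in>Arr E'. \<forall>g\<in>Arr E'. \<forall>h\<in>Arr E'. Cod E' f = Dom E' g \<longrightarrow> Cod E' g = Dom E' h \<longrightarrow>
      Comp E' h (Comp E' g f) = Comp E' (Comp E' h g) f"
    by clarsimp
qed

abbreviation "Pr \<equiv> base_change_proj :: ('j \<times> 'e, 'b \<times> 'm, 'e, 'm) ftr"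

lemma proj_sel [simp]:
  "on_obj Pr = snd" "on_arr Pr = snd"
  by (simp_all add: base_change_proj_def)

sublocale T: cat_functor E' E Pr
proof unfold_locales
  show "is_category E'" by (rule total_is_category)
  show "is_functor E' E Pr"
    unfolding is_functor_def by (intro conjI; clarsimp simp: hom_def)
qed

lemma fibre'_is_category: "i \<in> Obj I' \<Longrightarrow> is_category (fibre S' i)"
proof (rule fibre_is_category[OF total_is_category])
  show "is_category (base S')" using \<Phi>.C.is_category by simp
  show "is_functor E' (base S') (proj S')"
    unfolding is_functor_def by (intro conjI; clarsimp simp: hom_def)
qed simp

lemma fibre'_Arr:
  assumes "i \<in> Obj I'"
  shows "(f, m) \<in> Arr (fibre S' i) \<longleftrightarrow> f = Idt I' i \<and> m \<in> Arr (fibre S (on_obj \<phi> i))"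
proof (cases "f = Idt I' i")
  case True
  then show ?thesis using assms by auto
qed simp

lemma proj_fully_faithful: "fully_faithful E' E Pr"
  unfolding fully_faithful_def
proof (intro ballI, clarsimp)
  fix i V j W
  assume i: "i \<in> Obj I'" and V: "V \<in> Obj E" "on_obj \<phi> i = po V"
    and j: "j \<in> Obj I'" and W: "W \<in> Obj E" "on_obj \<phi> j = po W"
  show "bij_betw snd (hom E' (i, V) (j, W)) (hom E V W)"
  proof (rule bij_betw_imageI)
    show "inj_on snd (hom E' (i, V) (j, W))"
    proof (rule inj_onI, clarsimp)
      fix f g m assume "(f, m) \<in> hom E' (i, V) (j, W)" "(g, m) \<in> hom E' (i, V) (j, W)"
      then show "f = g"
        by (intro faithful[OF full_faith i j]) (auto simp: hom_def)
    qed
    show "snd ` hom E' (i, V) (j, W) = hom E V W"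
    proof
      show "snd ` hom E' (i, V) (j, W) \<subseteq> hom E V W" by (auto simp: hom_def)
      show "hom E V W \<subseteq> snd ` hom E' (i, V) (j, W)"
      proof
        fix m assume m: "m \<in> hom E V W"
        then have "pa m \<in> hom B (on_obj \<phi> i) (on_obj \<phi> j)" using V W by (auto simp: hom_def)
        from full[OF full_faith i j this] obtain f where "f \<in> hom I' i j" "on_arr \<phi> f = pa m" by blast
        then have "(f, m) \<in> hom E' (i, V) (j, W)" using m V W by (auto simp: hom_def)
        then show "m \<in> snd ` hom E' (i, V) (j, W)" by force
      qed
    qed
  qed
qed

lemma small_total:
  assumes U: "universe el" and I': "small_category el I'"
    and fib: "\<forall>i\<in>Obj I'. small_category el (fibre S' i)"
  shows "small el (Obj E')"
proof -
  have "small el (\<Union>i\<in>Obj I'. Obj (fibre S' i))"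
    using small_UN[OF U, of "Obj I'" "\<lambda>i. Obj (fibre S' i)"] I' fib
    by (simp add: small_category_def)
  moreover have "Obj E' \<subseteq> (\<Union>i\<in>Obj I'. Obj (fibre S' i))" by auto
  ultimately show ?thesis by (rule small_subset[OF U])
qed

text \<open>A covering sieve of the fibre over \<open>\<phi>(i)\<close> is a vertical covering in the base change.\<close>

lemma vertical_sieve:
  assumes i: "i \<in> Obj I'" and V: "(i, V) \<in> Obj E'"
    and Q: "is_sieve (fibre S (on_obj \<phi> i)) V Q" and cov: "Q \<in> fib_top S (on_obj \<phi> i) V"
  shows "vertical_covering S' (i, V) (Pair (Idt I' i) ` Q)"
proof -
  let ?F = "fibre S (on_obj \<phi> i)" and ?F' = "fibre S' i" and ?R = "Pair (Idt I' i) ` Q"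
  interpret F': category ?F' by unfold_locales (rule fibre'_is_category[OF i])
  have Qa: "m \<in> Arr ?F \<and> Cod E m = V" if "m \<in> Q" for m
    using Q that by (auto simp: is_sieve_def arrows_to_def)
  have Qc: "Comp E m n \<in> Q" if "m \<in> Q" "n \<in> Arr ?F" "Cod E n = Dom E m" for m n
    using Q that by (auto simp: is_sieve_def arrows_to_def)
  have "is_sieve ?F' (i, V) ?R"
    unfolding is_sieve_def
  proof (intro conjI ballI)
    show "?R \<subseteq> arrows_to ?F' (i, V)"
    proof clarify
      fix m assume "m \<in> Q"
      then have "(Idt I' i, m) \<in> Arr ?F'" unfolding fibre'_Arr[OF i] using Qa by blast
      moreover have "Cod ?F' (Idt I' i, m) = (i, V)"
        using conjunct2[OF Qa[OF \<open>m \<in> Q\<close>]] i by simp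
      ultimately show "(Idt I' i, m) \<in> arrows_to ?F' (i, V)"
        unfolding arrows_to_def by blast
    qed
  next
    fix x y assume "x \<in> ?R" and y: "y \<in> arrows_to ?F' (Dom ?F' x)"
    then obtain m where m: "m \<in> Q" and x: "x = (Idt I' i, m)" by blast
    obtain g n where yy: "y = (g, n)" by (cases y)
    have "(g, n) \<in> Arr ?F'" and dom: "Cod E' (g, n) = Dom E' x" using y by (auto simp: yy arrows_to_def)
    then have g: "g = Idt I' i" and n: "n \<in> Arr ?F" unfolding fibre'_Arr[OF i] by blast+
    have "Cod E n = Dom E m" using dom by (simp add: x)
    then have "Comp E m n \<in> Q" by (rule Qc[OF m n])
    then show "Comp ?F' x y \<in> ?R" using i by (simp add: x yy g)
  qed
  then have "sieve_generated ?F' ?R = ?R" and "?R \<subseteq> arrows_to ?F' (i, V)"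
    using F'.sieve_generated_sieve by (auto simp: is_sieve_def)
  moreover have "?R \<in> fib_top S' i (i, V)" using cov by simp
  moreover have "(i, V) \<in> Obj ?F'" using V by simp
  ultimately show ?thesis
    unfolding vertical_covering_def covering_family_def using i by (intro bexI[of _ i]) simp_all
qed

end

section \<open>The co-evanescent topologies\<close>

text \<open>The base change with its topologies: the inverse image functors are continuous, the topology of
  \<open>I'\<close> is the induced one, and every object of the base is covered by objects coming from \<open>I'\<close>.\<close>

locale coevanescent_base_change = base_changed S I' \<phi> JI'
  for S :: "('i, 'a, 'e, 'm) fsite" and I' :: "('j, 'b) cat" and \<phi> :: "('j, 'b, 'i, 'a) ftr"
    and JI' :: "('j, 'b) topol" +
  fixes el :: "'u \<Rightarrow> 'u set"
  assumes U: "universe el"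
    and base_site: "U_site el (base S) (base_top S)"
    and fibre_site: "i \<in> Obj (base S) \<Longrightarrow> U_site el (fibre S i) (fib_top S i)"
    and inv_image_continuous: "f \<in> Arr (base S) \<Longrightarrow> continuous_functor el
          (fibre S (Cod (base S) f)) (fib_top S (Cod (base S) f))
          (fibre S (Dom (base S) f)) (fib_top S (Dom (base S) f)) (inv_image S f)"
    and induced: "is_induced_topology el I' JI' (base S) (base_top S) \<phi>"
    and base_dense: "dense_functor I' (base S) (base_top S) \<phi>"
begin

abbreviation "J \<equiv> coevanescent_topology S"
abbreviation "J' \<equiv> coevanescent_topology S'"

lemma J_topology: "is_topology E J" and J'_topology: "is_topology E' J'"
  by (rule coevanescent_is_topology[OF P.C.is_category],
      rule coevanescent_is_topology[OF total_is_category])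

lemma base_topology: "is_topology B (base_top S)"
  by (rule U_site_topology[OF base_site])

lemma base_continuous: "continuous_functor el I' JI' B (base_top S) \<phi>"
  using induced by (simp add: is_induced_topology_def)

text \<open>An object \<open>V\<close> is covered by its inverse images along a covering of its projection by objects
  coming from \<open>I'\<close>.\<close>

lemma proj_dense: "dense_functor E' E J Pr"
  unfolding dense_functor_def
proof
  fix V assume V: "V \<in> Obj E"
  then have "po V \<in> Obj B" by simp
  from dense_functorD[OF base_dense this] obtain R where R: "covering_family B (base_top S) (po V) R"
    and dom: "\<forall>f\<in>R. Dom B f \<in> on_obj \<phi> ` Obj I'" by blast
  let ?R = "(\<lambda>f. cleavage S f V) ` R"
  have Ra: "f \<in> Arr B" "po V = Cod B f" if "f \<in> R" for f
    using R that by (auto simp: covering_family_def arrows_to_def)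
  note c = cleavage_props[OF Ra(1) V Ra(2)]
  have "pa ` ?R = R" using c(3) by (force simp: image_image)
  have "cartesian_covering S V ?R"
    unfolding cartesian_covering_def
  proof (intro conjI ballI)
    show "V \<in> Obj E" by fact
    show "?R \<subseteq> arrows_to E V" using c by (auto simp: arrows_to_def)
    show "covering_family B (base_top S) (po V) (pa ` ?R)"
      unfolding \<open>pa ` ?R = R\<close> by (rule R)
    fix m assume "m \<in> ?R"
    then obtain f where f: "f \<in> R" and m: "m = cleavage S f V" by blast
    note cf = c[OF f f]
    have W: "Dom E m \<in> Obj (fibre S (Dom B f))" and pf: "pa m = f" using cf by (simp_all add: m)
    interpret F: category "fibre S (Dom B f)"
      by unfold_locales (rule U_site_category[OF fibre_site], use Ra[OF f] in simp)
    let ?h = "Idt E (Dom E m)"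
    have id: "?h \<in> hom (fibre S (Dom B f)) (Dom E m) (Dom E m)"
      using F.Idt_Arr[OF W] F.Dom_Idt[OF W] F.Cod_Idt[OF W] by (simp add: hom_def)
    moreover have "is_iso (fibre S (Dom B f)) ?h"
      unfolding is_iso_def using id W by (intro conjI bexI[of _ ?h]) (simp_all add: hom_def)
    moreover have "m = Comp E (cleavage S f V) ?h" using cf by (simp add: m)
    ultimately show "\<exists>h. h \<in> hom (fibre S (Dom B (pa m))) (Dom E m) (on_obj (inv_image S (pa m)) V) \<and>
        is_iso (fibre S (Dom B (pa m))) h \<and> m = Comp E (cleavage S (pa m) V) h"
      unfolding pf by (intro exI[of _ ?h]) (simp add: inv_image_def m)
  qed
  then have "covering_family E J V ?R"
    using coevanescent_covering[OF P.C.is_category V] by blast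
  moreover have "\<forall>m\<in>?R. Dom E m \<in> on_obj Pr ` Obj E'"
  proof
    fix m assume "m \<in> ?R"
    then obtain f where f: "f \<in> R" and m: "m = cleavage S f V" by blast
    note cf = c[OF f f]
    obtain i where "i \<in> Obj I'" "on_obj \<phi> i = Dom B f" using dom f by force
    then have "(i, Dom E m) \<in> Obj E'" using cf by (simp add: m)
    then show "Dom E m \<in> on_obj Pr ` Obj E'"
      by (rule image_eqI[rotated]) simp
  qed
  ultimately show "\<exists>R. covering_family E J V R \<and> (\<forall>f\<in>R. Dom E f \<in> on_obj Pr ` Obj E')"
    by blast
qed

subsection \<open>Continuity of the projection\<close>

lemma image_covering:
  assumes V: "(i, V) \<in> Obj E'" and R: "R \<subseteq> arrows_to E' (i, V)"
    and Q: "covering_family E J V Q" and sub: "Q \<subseteq> snd ` sieve_generated E' R"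
  shows "covering_family E' (image_topology E' E J Pr) (i, V) R"
proof -
  note sv = T.C.sieve_generated_is_sieve[OF R]
  note im = T.image_arrows_to[OF sv]
  have "Q \<subseteq> sieve_generated E (on_arr Pr ` sieve_generated E' R)"
    using sub P.C.subset_sieve_generated[OF im] by simp
  then have "sieve_generated E (on_arr Pr ` sieve_generated E' R) \<in>
      J (on_obj Pr (i, V))"
    using P.C.covering_family_mono[OF J_topology _ _ P.C.sieve_generated_is_sieve[OF im]] Q V by simp
  then show ?thesis using R sv by (simp add: covering_family_def image_topology_def)
qed

lemma vertical_image_covering:
  assumes V: "(i, V) \<in> Obj E'" and R: "vertical_covering S' (i, V) R"
  shows "covering_family E' (image_topology E' E J Pr) (i, V) R"
proof -
  have R': "covering_family (fibre S' i) (fib_top S' i) (i, V) R"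
    using R by (auto simp: vertical_covering_def)
  have i: "i \<in> Obj I'" and VE: "V \<in> Obj E" and pV: "on_obj \<phi> i = po V" using V by simp_all
  have pB: "po V \<in> Obj B" using VE by simp
  note site = fibre_site[OF pB]
  interpret F: category "fibre S (po V)"
    by unfold_locales (rule U_site_category[OF site])
  have VF: "V \<in> Obj (fibre S (po V))" using VE by simp
  obtain Q where Q: "Q \<in> fib_top S (po V) V" and gen: "sieve_generated (fibre S' i) R = Pair (Idt I' i) ` Q"
    using R' pV by (auto simp: covering_family_def)
  have "vertical_covering S V Q"
    unfolding vertical_covering_def
    using pB VF F.covering_sieve[OF U_site_topology[OF site] VF Q] by blast
  then have Qc: "covering_family E J V Q"
    using coevanescent_covering[OF P.C.is_category VE] by blast
  show ?thesis
  proof (rule image_covering[OF V _ Qc])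
    show "R \<subseteq> arrows_to E' (i, V)"
      by (rule coevanescent_generator_subset) (use R in blast)
    have "sieve_generated (fibre S' i) R \<subseteq> sieve_generated E' R"
      by (auto simp: sieve_generated_def arrows_to_def)
    then have "snd ` Pair (Idt I' i) ` Q \<subseteq> snd ` sieve_generated E' R"
      unfolding gen by (rule image_mono)
    then show "Q \<subseteq> snd ` sieve_generated E' R"
      by (simp add: image_image)
  qed
qed

text \<open>The projection to \<open>E\<close> of a cartesian covering is a cartesian covering, because the continuous
  functor \<open>\<phi>\<close> preserves covering families.\<close>

lemma cartesian_image_covering:
  assumes V: "(i, V) \<in> Obj E'" and R: "cartesian_covering S' (i, V) R"
  shows "covering_family E' (image_topology E' E J Pr) (i, V) R"
proof -
  have i: "i \<in> Obj I'" and VE: "V \<in> Obj E" and pV: "on_obj \<phi> i = po V" using V by simp_all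
  have Ra: "R \<subseteq> arrows_to E' (i, V)" and cov: "covering_family I' JI' i (fst ` R)"
    using R by (simp_all add: cartesian_covering_def)
  have R_mem: "(f, n) \<in> Arr E' \<and> Cod I' f = i \<and> Cod E n = V" if "(f, n) \<in> R" for f n
    using Ra that by (auto simp: arrows_to_def)
  have iso: "\<exists>h. h \<in> hom (fibre S' (Dom I' f)) (Dom I' f, Dom E n)
        (on_obj (inv_image S' f) (i, V)) \<and>
      is_iso (fibre S' (Dom I' f)) h \<and> (f, n) = Comp E' (f, cleavage S (on_arr \<phi> f) V) h"
    if "(f, n) \<in> R" for f n
    using bspec[OF conjunct2[OF conjunct2[OF conjunct2[OF R[unfolded cartesian_covering_def]]]] that]
    by (simp only: base_change_sel fst_conv total_sel)
  have "pa ` snd ` R = on_arr \<phi> ` fst ` R"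
  proof -
    have "pa (snd x) = on_arr \<phi> (fst x)" if "x \<in> R" for x
      using R_mem that by (cases x) fastforce
    then show ?thesis by (force simp: image_image)
  qed
  moreover have "covering_family B (base_top S) (po V) (on_arr \<phi> ` fst ` R)"
    using continuous_preserves_covering[OF U \<Phi>.C.is_category base_site base_continuous i cov]
    by (simp add: pV)
  ultimately have covB: "covering_family B (base_top S) (po V) (pa ` snd ` R)" by simp
  have "cartesian_covering S V (snd ` R)"
    unfolding cartesian_covering_def
  proof (intro conjI ballI)
    show "V \<in> Obj E" by fact
    show "snd ` R \<subseteq> arrows_to E V" using R_mem by (auto simp: arrows_to_def)
    show "covering_family B (base_top S) (po V) (pa ` snd ` R)" by fact
    fix n assume "n \<in> snd ` R"
    then obtain f where fn: "(f, n) \<in> R" by auto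
    have fa: "f \<in> Arr I'" "n \<in> Arr E" "on_arr \<phi> f = pa n" using R_mem[OF fn] by simp_all
    have j: "Dom I' f \<in> Obj I'" and dB: "on_obj \<phi> (Dom I' f) = Dom B (pa n)"
      using fa(1) \<Phi>.functor_Dom[OF fa(1)] by (simp_all add: fa(3))
    obtain h where h: "h \<in> hom (fibre S' (Dom I' f)) (Dom I' f, Dom E n) (on_obj (inv_image S' f) (i, V))"
      and isoh: "is_iso (fibre S' (Dom I' f)) h" and eq: "(f, n) = Comp E' (f, cleavage S (on_arr \<phi> f) V) h"
      using iso[OF fn] by blast
    obtain h1 h2 where hh: "h = (h1, h2)" by (cases h)
    have "(h1, h2) \<in> Arr (fibre S' (Dom I' f))" using h unfolding hom_def hh by blast
    then have h2: "h2 \<in> Arr (fibre S (Dom B (pa n)))"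
      unfolding fibre'_Arr[OF j] dB by blast
    have dc: "Dom E h2 = Dom E n" "Cod E h2 = on_obj (inv_image S (pa n)) V"
      using h by (simp_all add: hom_def hh inv_image_def fa(3))
    obtain g where g: "g \<in> hom (fibre S' (Dom I' f)) (Cod E' h) (Dom E' h)"
      and inv: "Comp E' g h = Idt E' (Dom E' h)" "Comp E' h g = Idt E' (Cod E' h)"
      using isoh unfolding is_iso_def by auto
    obtain g1 g2 where gg: "g = (g1, g2)" by (cases g)
    have "(g1, g2) \<in> Arr (fibre S' (Dom I' f))" using g unfolding hom_def gg by blast
    then have g2: "g2 \<in> Arr (fibre S (Dom B (pa n)))"
      unfolding fibre'_Arr[OF j] dB by blast
    have dg: "Dom E g2 = Cod E h2" "Cod E g2 = Dom E h2"
      using g by (simp_all add: hom_def hh gg)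
    have inv2: "Comp E g2 h2 = Idt E (Dom E h2)" "Comp E h2 g2 = Idt E (Cod E h2)"
      using inv by (simp_all add: hh gg)
    have "is_iso (fibre S (Dom B (pa n))) h2"
      unfolding is_iso_def hom_def using h2 g2 dg inv2 by (intro conjI bexI[of _ g2]) simp_all
    moreover have "n = Comp E (cleavage S (pa n) V) h2" using eq by (simp add: hh fa(3))
    ultimately show "\<exists>h. h \<in> hom (fibre S (Dom B (pa n))) (Dom E n) (on_obj (inv_image S (pa n)) V) \<and>
        is_iso (fibre S (Dom B (pa n))) h \<and> n = Comp E (cleavage S (pa n) V) h"
      using h2 dc unfolding hom_def by (intro exI[of _ h2]) simp
  qed
  then have "covering_family E J V (snd ` R)"
    using coevanescent_covering[OF P.C.is_category VE] by blast
  then show ?thesis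
    by (rule image_covering[OF V Ra]) (rule image_mono[OF T.C.subset_sieve_generated[OF Ra]])
qed

lemma J'_le_image: "J' X \<subseteq> image_topology E' E J Pr X"
  unfolding coevanescent_topology_def[of S']
proof (rule generated_topology_least[OF T.image_topology_is_topology[OF J_topology proj_dense proj_fully_faithful]])
  fix Y R assume "Y \<in> Obj E'" and "vertical_covering S' Y R \<or> cartesian_covering S' Y R"
  then show "covering_family E' (image_topology E' E J Pr) Y R"
    using vertical_image_covering cartesian_image_covering by (cases Y) blast
qed

lemma proj_continuous: "continuous_functor el E' J' E J Pr"
  unfolding continuous_functor_def
proof (intro conjI allI impI)
  show "is_functor E' E Pr" by (rule T.is_functor)
  fix F assume "is_sheaf el E J F"
  then have "is_sheaf el E' (image_topology E' E J Pr) (presheaf_comp F Pr)"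
    using T.image_topology_continuous[OF J_topology proj_dense proj_fully_faithful, of el]
    unfolding continuous_functor_def by blast
  then show "is_sheaf el E' J' (presheaf_comp F Pr)"
    using J'_le_image unfolding is_sheaf_def by blast
qed

subsection \<open>Cocontinuity of the projection\<close>

text \<open>Write \<open>m: X \<rightarrow> V\<close> as the canonical arrow over its projection \<open>f\<close> after a vertical arrow
  \<open>b: X \<rightarrow> f\<^sup>+(V)\<close>.  The pullback along \<open>b\<close> of the image of \<open>R\<close> under \<open>f\<^sup>+\<close>
  is a vertical covering of \<open>X\<close>, all of whose members become multiples of members of \<open>R\<close>.\<close>

lemma vertical_pull:
  assumes V: "V \<in> Obj E" and R: "vertical_covering S V R"
    and Y: "(j, X) \<in> Obj E'" and m: "m \<in> hom E X V"
  shows "functor_pull E' E Pr (j, X) m (sieve_generated E R) \<in> J' (j, X)"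
proof -
  let ?i = "po V" and ?f = "pa m"
  let ?F = "fibre S (on_obj \<phi> j)"
  have Rc: "covering_family (fibre S ?i) (fib_top S ?i) V R"
    using R by (auto simp: vertical_covering_def)
  have ma: "m \<in> Arr E" "Dom E m = X" "Cod E m = V" using m by (auto simp: hom_def)
  have j: "j \<in> Obj I'" and XE: "X \<in> Obj E" and pX: "on_obj \<phi> j = po X" using Y by simp_all
  have f: "?f \<in> Arr B" and fD: "Dom B ?f = on_obj \<phi> j" and fC: "?i = Cod B ?f"
    using ma pX by simp_all
  have jB: "on_obj \<phi> j \<in> Obj B" and iB: "?i \<in> Obj B" using j V by simp_all
  note site = fibre_site[OF jB]
  note top = U_site_topology[OF site]
  interpret F: category ?F by unfold_locales (rule U_site_category[OF site])
  note c = cleavage_props[OF f V fC]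
  let ?c = "cleavage S ?f V" and ?W = "Dom E (cleavage S ?f V)"
  have WF: "?W \<in> Obj ?F" using c fD by simp
  obtain b where b: "b \<in> hom ?F X ?W" and mb: "Comp E ?c b = m"
    using cleavage_vertical_factorization[OF f V fC ma(1,3) refl] fD ma(2) by auto
  let ?u = "inv_image S ?f"
  let ?R1 = "on_arr ?u ` R"
  have VF: "V \<in> Obj (fibre S ?i)" using V by simp
  have "continuous_functor el (fibre S ?i) (fib_top S ?i) ?F (fib_top S (on_obj \<phi> j)) ?u"
    using inv_image_continuous[OF f] by (simp add: fC[symmetric] fD)
  from continuous_preserves_covering[OF U U_site_category[OF fibre_site[OF iB]] site this VF Rc]
  have R1: "covering_family ?F (fib_top S (on_obj \<phi> j)) ?W ?R1"
    by (simp add: inv_image_def)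
  let ?P = "sieve_generated ?F ?R1"
  have P: "?P \<in> fib_top S (on_obj \<phi> j) ?W" using R1 by (simp add: covering_family_def)
  have bF: "b \<in> arrows_to ?F ?W" "Dom ?F b = X" using b unfolding hom_def arrows_to_def by auto
  let ?Q = "pull_sieve ?F b ?P"
  have Q: "?Q \<in> fib_top S (on_obj \<phi> j) X" using topology_pull[OF top WF P bF(1)] bF(2) by simp
  have XF: "X \<in> Obj ?F" using XE pX by simp
  have "vertical_covering S' (j, X) (Pair (Idt I' j) ` ?Q)"
    by (rule vertical_sieve[OF j Y topology_sieve[OF top XF Q] Q])
  then have cov: "covering_family E' J' (j, X) (Pair (Idt I' j) ` ?Q)"
    using coevanescent_covering[OF total_is_category Y] by blast
  have RE: "R \<subseteq> arrows_to E V"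
    by (rule coevanescent_generator_subset) (use R in blast)
  have mh: "m \<in> hom E (on_obj Pr (j, X)) V" using m by simp
  show ?thesis
  proof (rule T.C.covering_family_mono[OF J'_topology Y cov])
    show "is_sieve E' (j, X) (functor_pull E' E Pr (j, X) m (sieve_generated E R))"
      by (rule T.functor_pull_is_sieve[OF P.C.sieve_generated_is_sieve[OF RE] mh])
    show "Pair (Idt I' j) ` ?Q \<subseteq> functor_pull E' E Pr (j, X) m (sieve_generated E R)"
    proof clarify
      fix q assume q: "q \<in> ?Q"
      then have qa: "q \<in> Arr ?F" "Cod E q = X" and "Comp E b q \<in> ?P"
        using bF(2) by (auto simp: pull_sieve_def arrows_to_def)
      then obtain r d where r: "r \<in> R" and d: "d \<in> Arr ?F" "Cod E d = Dom E (on_arr ?u r)"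
        and bq: "Comp E b q = Comp E (on_arr ?u r) d"
        by (auto simp: sieve_generated_def arrows_to_def)
      have rF: "r \<in> Arr (fibre S (Cod B ?f))" and rV: "Cod E r = V"
        using Rc r unfolding covering_family_def arrows_to_def fC[symmetric] by auto
      note sq = inv_image_square[OF f rF]
      have ba: "b \<in> Arr E" "Dom E b = X" "Cod E b = ?W" using b by (auto simp: hom_def)
      have rW: "Dom E r \<in> Obj E" "po (Dom E r) = Cod B ?f" using rF by simp_all
      note cr = cleavage_props[OF f rW]
      have ra: "r \<in> Arr E" using rF by simp
      let ?n = "on_arr ?u r"
      have na: "?n \<in> Arr E" "Dom E ?n = Dom E (cleavage S ?f (Dom E r))" "Cod E ?n = ?W"
        using sq(1) by (auto simp: hom_def rV)
      have qE: "q \<in> Arr E" and dE: "d \<in> Arr E" using qa d by simp_all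
      have "Comp E (Comp E ?c b) q = Comp E ?c (Comp E b q)"
        using c ba qa(2) qE by (intro P.C.Comp_assoc) simp_all
      then have "Comp E m q = Comp E ?c (Comp E b q)" by (simp only: mb)
      also have "\<dots> = Comp E (Comp E ?c ?n) d"
        unfolding bq using c na d(2) dE by simp
      also have "\<dots> = Comp E r (Comp E (cleavage S ?f (Dom E r)) d)"
        using sq(2) cr ra na d(2) dE by (simp add: rV)
      finally have eq: "Comp E m q = Comp E r (Comp E (cleavage S ?f (Dom E r)) d)" .
      have "Comp E (cleavage S ?f (Dom E r)) d \<in> arrows_to E (Dom E r)"
        using cr na d(2) dE by (simp add: arrows_to_def)
      then have mem: "Comp E m q \<in> sieve_generated E R"
        using r eq unfolding sieve_generated_def by blast
      have "(Idt I' j, q) \<in> Arr (fibre S' j)" unfolding fibre'_Arr[OF j] using qa(1) by blast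
      then have "(Idt I' j, q) \<in> Arr E'" unfolding fibre_sel by blast
      then show "(Idt I' j, q) \<in> functor_pull E' E Pr (j, X) m (sieve_generated E R)"
        using mem qa(2) j by (simp add: functor_pull_def arrows_to_def del: total_Arr)
    qed
  qed
qed

text \<open>The arrows \<open>g\<close> of \<open>I'\<close> for which \<open>pa m\<close> after \<open>\<phi>(g)\<close> lies in the sieve of the base
  generated by the projection of \<open>R\<close> form a covering sieve.  For such a \<open>g\<close>, the composite of \<open>m\<close>
  with the canonical arrow over \<open>\<phi>(g)\<close> factors through a member of \<open>R\<close>.\<close>

lemma cartesian_pull:
  assumes V: "V \<in> Obj E" and R: "cartesian_covering S V R"
    and Y: "(j, X) \<in> Obj E'" and m: "m \<in> hom E X V"
  shows "functor_pull E' E Pr (j, X) m (sieve_generated E R) \<in> J' (j, X)"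
proof -
  have ma: "m \<in> Arr E" "Dom E m = X" "Cod E m = V" using m by (auto simp: hom_def)
  have j: "j \<in> Obj I'" and XE: "X \<in> Obj E" and pX: "on_obj \<phi> j = po X" using Y by simp_all
  have f: "pa m \<in> hom B (on_obj \<phi> j) (po V)" using ma pX by (simp add: hom_def)
  have Rc: "covering_family B (base_top S) (po V) (pa ` R)" and RE: "R \<subseteq> arrows_to E V"
    using R by (simp_all add: cartesian_covering_def)
  have R_iso: "\<exists>h. h \<in> hom (fibre S (Dom B (pa r))) (Dom E r) (on_obj (inv_image S (pa r)) V) \<and>
      is_iso (fibre S (Dom B (pa r))) h \<and> r = Comp E (cleavage S (pa r) V) h" if "r \<in> R" for r
    using R that by (simp add: cartesian_covering_def)
  let ?Z = "sieve_generated B (pa ` R)"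
  let ?Q = "functor_pull I' B \<phi> j (pa m) ?Z"
  have Z: "?Z \<in> base_top S (po V)" using Rc by (simp add: covering_family_def)
  have pV: "po V \<in> Obj B" using V by simp
  \<comment> \<open>The induced topology is the finest one for which \<open>\<phi>\<close> is continuous, so it contains the image
    topology.\<close>
  have "is_topology I' (image_topology I' B (base_top S) \<phi>)"
    by (rule \<Phi>.image_topology_is_topology[OF base_topology base_dense full_faith])
  moreover have "continuous_functor el I' (image_topology I' B (base_top S) \<phi>) B (base_top S) \<phi>"
    by (rule \<Phi>.image_topology_continuous[OF base_topology base_dense full_faith])
  ultimately have "image_topology I' B (base_top S) \<phi> j \<subseteq> JI' j"
    using induced j unfolding is_induced_topology_def by blast
  moreover have "?Q \<in> image_topology I' B (base_top S) \<phi> j"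
    using \<Phi>.image_topology_cocontinuous[OF base_topology base_dense full_faith] pV Z j f
    unfolding cocontinuous_def by blast
  ultimately have QJ: "?Q \<in> JI' j" by blast
  have I'_top: "is_topology I' JI'" using induced by (simp add: is_induced_topology_def)
  have Qs: "is_sieve I' j ?Q" by (rule topology_sieve[OF I'_top j QJ])
  have Qa: "g \<in> Arr I' \<and> Cod I' g = j" if "g \<in> ?Q" for g
    using that by (auto simp: functor_pull_def arrows_to_def)
  let ?cl = "\<lambda>g. cleavage S (on_arr \<phi> g) X"
  let ?R = "(\<lambda>g. (g, ?cl g)) ` ?Q"
  have cl: "?cl g \<in> Arr E" "Cod E (?cl g) = X" "pa (?cl g) = on_arr \<phi> g"
    "po (Dom E (?cl g)) = on_obj \<phi> (Dom I' g)" if "g \<in> ?Q" for g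
  proof -
    have g: "on_arr \<phi> g \<in> Arr B" "po X = Cod B (on_arr \<phi> g)" using Qa[OF that] pX by simp_all
    note c = cleavage_props[OF g(1) XE g(2)]
    show "?cl g \<in> Arr E" "Cod E (?cl g) = X" "pa (?cl g) = on_arr \<phi> g"
      "po (Dom E (?cl g)) = on_obj \<phi> (Dom I' g)"
      using c Qa[OF that] by simp_all
  qed
  have R_arr: "(g, ?cl g) \<in> Arr E'" if "g \<in> ?Q" for g
    using cl[OF that] Qa[OF that] pX by simp
  have "cartesian_covering S' (j, X) ?R"
    unfolding cartesian_covering_def
  proof (intro conjI ballI)
    show "(j, X) \<in> Obj E'" by (rule Y)
    show "?R \<subseteq> arrows_to E' (j, X)"
    proof clarify
      fix g assume g: "g \<in> ?Q"
      then show "(g, ?cl g) \<in> arrows_to E' (j, X)"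
        unfolding arrows_to_def using R_arr[OF g] cl[OF g] Qa[OF g] by simp
    qed
    have "fst ` ?R = ?Q" by (force simp: image_image)
    then show "covering_family (base S') (base_top S') (on_obj (proj S') (j, X)) (on_arr (proj S') ` ?R)"
      using \<Phi>.C.covering_sieve[OF I'_top j QJ] by simp
    fix x assume "x \<in> ?R"
    then obtain g where g: "g \<in> ?Q" and x: "x = (g, ?cl g)" by blast
    let ?k = "Dom I' g" and ?W = "Dom E (?cl g)"
    have k: "?k \<in> Obj I'" using Qa[OF g] by simp
    interpret F': category "fibre S' ?k" by unfold_locales (rule fibre'_is_category[OF k])
    have W: "(?k, ?W) \<in> Obj (fibre S' ?k)" using k cl[OF g] by simp
    let ?h = "Idt E' (?k, ?W)"
    have "?h \<in> Arr (fibre S' ?k)" and "Dom E' ?h = (?k, ?W)" and "Cod E' ?h = (?k, ?W)"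
      using F'.Idt_Arr[OF W] F'.Dom_Idt[OF W] F'.Cod_Idt[OF W] unfolding fibre_sel(3-6) by blast+
    then have id: "?h \<in> hom (fibre S' ?k) (?k, ?W) (?k, ?W)" unfolding hom_def fibre_sel(3-6) by blast
    have hh: "Comp E' ?h ?h = ?h"
      using k cl[OF g] by simp
    have "is_iso (fibre S' ?k) ?h"
      unfolding is_iso_def
      using id hh unfolding hom_def fibre_sel(3-6) by (intro conjI bexI[of _ ?h]) auto
    moreover have "x = Comp E' (cleavage S' g (j, X)) ?h"
      using Qa[OF g] cl[OF g] by (simp add: x)
    ultimately show "\<exists>h. h \<in> hom (fibre S' (Dom (base S') (on_arr (proj S') x))) (Dom E' x)
          (on_obj (inv_image S' (on_arr (proj S') x)) (j, X)) \<and>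
        is_iso (fibre S' (Dom (base S') (on_arr (proj S') x))) h \<and>
        x = Comp E' (cleavage S' (on_arr (proj S') x) (j, X)) h"
      using id by (intro exI[of _ ?h]) (simp add: x inv_image_def)
  qed
  then have cov: "covering_family E' J' (j, X) ?R"
    using coevanescent_covering[OF total_is_category Y] by blast
  have mh: "m \<in> hom E (on_obj Pr (j, X)) V" using m by simp
  show ?thesis
  proof (rule T.C.covering_family_mono[OF J'_topology Y cov])
    show "is_sieve E' (j, X) (functor_pull E' E Pr (j, X) m (sieve_generated E R))"
      by (rule T.functor_pull_is_sieve[OF P.C.sieve_generated_is_sieve[OF RE] mh])
    show "?R \<subseteq> functor_pull E' E Pr (j, X) m (sieve_generated E R)"
    proof clarify
      fix g assume g: "g \<in> ?Q"
      then have "Comp B (pa m) (on_arr \<phi> g) \<in> ?Z" by (simp add: functor_pull_def)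
      then obtain r k where r: "r \<in> R" and k: "k \<in> Arr B" "Cod B k = Dom B (pa r)"
        and eq: "Comp B (pa m) (on_arr \<phi> g) = Comp B (pa r) k"
        by (auto simp: sieve_generated_def arrows_to_def)
      have ra: "r \<in> Arr E" "Cod E r = V" using RE r by (auto simp: arrows_to_def)
      have pr: "pa r \<in> Arr B" "po V = Cod B (pa r)" using ra by simp_all
      let ?n = "Comp E m (?cl g)" and ?c = "cleavage S (pa r) V"
      have n: "?n \<in> Arr E" "Cod E ?n = V" "pa ?n = Comp B (pa r) k"
        using ma cl[OF g] eq by simp_all
      obtain d where d: "d \<in> Arr E" "Cod E d = Dom E ?c" "Comp E ?c d = ?n"
        using cleavage_factorization[OF pr(1) V pr(2) n(1,2) k n(3)] by blast
      note c = cleavage_props[OF pr(1) V pr(2)]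
      obtain h where h: "h \<in> hom (fibre S (Dom B (pa r))) (Dom E r) (on_obj (inv_image S (pa r)) V)"
        and iso: "is_iso (fibre S (Dom B (pa r))) h" and rh: "r = Comp E ?c h"
        using R_iso[OF r] by blast
      have ha: "h \<in> Arr E" "Dom E h = Dom E r" "Cod E h = Dom E ?c"
        using h by (auto simp: hom_def inv_image_def)
      obtain h' where h': "h' \<in> Arr E" "Dom E h' = Cod E h" "Cod E h' = Dom E h"
        "Comp E h h' = Idt E (Cod E h)"
        using iso by (auto simp: is_iso_def hom_def)
      \<comment> \<open>The isomorphism \<open>h\<close> transports the factorization through the canonical arrow \<open>?c\<close> into one
        through \<open>r\<close>.\<close>
      have "Comp E r (Comp E h' d) = Comp E (Comp E ?c h) (Comp E h' d)" by (simp only: rh[symmetric])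
      also have "\<dots> = Comp E ?c (Comp E (Comp E h h') d)"
        using c ha h'(1-3) d by simp
      also have "\<dots> = ?n" using ha d by (simp add: h'(4))
      finally have "?n = Comp E r (Comp E h' d)" by simp
      moreover have "Comp E h' d \<in> arrows_to E (Dom E r)"
        using ha h' d by (simp add: arrows_to_def)
      ultimately have mem: "?n \<in> sieve_generated E R"
        using r unfolding sieve_generated_def by blast
      have "Cod E' (g, ?cl g) = (j, X)" using cl[OF g] Qa[OF g] by simp
      then show "(g, ?cl g) \<in> functor_pull E' E Pr (j, X) m (sieve_generated E R)"
        unfolding functor_pull_def arrows_to_def using R_arr[OF g] mem by simp
    qed
  qed
qed

lemma proj_cocontinuous: "cocontinuous E' J' E J Pr"
  unfolding coevanescent_topology_def[of S]
proof (rule T.cocontinuous_generated[OF J'_topology])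
  show "R \<subseteq> arrows_to E V" if "vertical_covering S V R \<or> cartesian_covering S V R" for V R
    using that by (rule coevanescent_generator_subset)
next
  fix V R Y m assume V: "V \<in> Obj E" and R: "vertical_covering S V R \<or> cartesian_covering S V R"
    and Y: "Y \<in> Obj E'" and m: "m \<in> hom E (on_obj Pr Y) V"
  obtain j X where jX: "Y = (j, X)" by (cases Y)
  show "functor_pull E' E Pr Y m (sieve_generated E R) \<in> J' Y"
    using R vertical_pull[OF V, of R j X m] cartesian_pull[OF V, of R j X m] Y m
    unfolding jX by auto
qed

lemma coevanescent_induced:
  assumes I'_small: "small_category el I'" and fib_small: "\<forall>i\<in>Obj I'. small_category el (fibre S' i)"
  shows "is_induced_topology el E' J' E J Pr"
  unfolding is_induced_topology_def
proof (intro conjI allI impI ballI subsetI)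
  show "is_topology E' J'" by (rule J'_topology)
  show "continuous_functor el E' J' E J Pr" by (rule proj_continuous)
  fix J'' X R assume J'': "is_topology E' J''" and cont: "continuous_functor el E' J'' E J Pr"
    and X: "X \<in> Obj E'" and R: "R \<in> J'' X"
  have ls: "locally_small el E"
    using total_locally_small[OF U U_site_locally_small[OF base_site]]
      U_site_locally_small[OF fibre_site] by blast
  show "R \<in> J' X"
  proof (rule T.covering_if_separated[OF U J'_topology J_topology proj_cocontinuous
        proj_fully_faithful subset_refl small_total[OF U I'_small fib_small] _ ls X
        topology_sieve[OF J'' X R]])
    fix Y assume Y: "Y \<in> Obj E'"
    have "covering_family E' J' Y (arrows_to E' Y)"
      by (rule T.C.covering_sieve[OF J'_topology Y topology_max[OF J'_topology Y]])
    then show "\<exists>R. covering_family E' J' Y R \<and> (\<forall>f\<in>R. Dom E' f \<in> Obj E')"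
      by (intro exI[of _ "arrows_to E' Y"]) (simp add: arrows_to_def)
  next
    fix F s t assume F: "is_sheaf el E J F"
      and s: "s \<in> el (section_set F (on_obj Pr X))"
      and t: "t \<in> el (section_set F (on_obj Pr X))"
      and eq: "\<And>f. f \<in> R \<Longrightarrow> restrict_along F (on_arr Pr f) s =
        restrict_along F (on_arr Pr f) t"
    have F': "is_sheaf el E' J'' (presheaf_comp F Pr)"
      using cont F by (simp add: continuous_functor_def)
    show "s = t"
      by (rule T.C.sheaf_separated[OF F' X T.C.covering_sieve[OF J'' X R]])
        (use s t eq in \<open>simp_all add: presheaf_comp_def\<close>)
  qed
qed

end

theorem proposition5p22:
  fixes el :: "'u \<Rightarrow> 'u set"
    and S :: "('i, 'a, 'e, 'm) fsite"
    and I' :: "('j, 'b) cat"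
    and JI' :: "('j, 'b) topol"
    and \<phi> :: "('j, 'b, 'i, 'a) ftr"
  defines "S' \<equiv> base_change S I' JI' \<phi>"
  assumes "universe el"
    and "fibred_site el S"
    and "U_site el I' JI'"
    and "has_fibre_products I'"
    and "continuous_functor el I' JI' (base S) (base_top S) \<phi>"
    and "preserves_fibre_products I' (base S) \<phi>"
    and "small_category el I'"
    and "fully_faithful I' (base S) \<phi>"
    and "is_induced_topology el I' JI' (base S) (base_top S) \<phi>"
    and "\<forall>i\<in>Obj (base S). \<exists>R. covering_family (base S) (base_top S) i R \<and>
           (\<forall>f\<in>R. Dom (base S) f \<in> on_obj \<phi> ` Obj I')"
    and "\<forall>i'\<in>Obj I'. small_category el (fibre S' i')"
  shows "is_induced_topology el
           (total_cat S') (coevanescent_topology S')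
           (total_cat S) (coevanescent_topology S)
           base_change_proj"
proof -
  note S = \<open>fibred_site el S\<close>[unfolded fibred_site_def]
  have base: "U_site el (base S) (base_top S)" and fibred: "is_fibred S"
    and norm: "is_normalized_cleavage S"
    and fib: "\<And>i. i \<in> Obj (base S) \<Longrightarrow> U_site el (fibre S i) (fib_top S i)"
    and inv: "\<And>f. f \<in> Arr (base S) \<Longrightarrow> continuous_functor el
          (fibre S (Cod (base S) f)) (fib_top S (Cod (base S) f))
          (fibre S (Dom (base S) f)) (fib_top S (Dom (base S) f)) (inv_image S f)"
    using S by blast+
  have I': "is_category I'" by (rule U_site_category) fact
  have B: "is_category (base S)" by (rule U_site_category[OF base])
  have phi: "is_functor I' (base S) \<phi>" using assms(6) by (simp add: continuous_functor_def)
  have dense: "dense_functor I' (base S) (base_top S) \<phi>"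
    unfolding dense_functor_def by fact
  interpret coevanescent_base_change S I' \<phi> JI' el
    using fibred norm I' B phi \<open>fully_faithful I' (base S) \<phi>\<close> \<open>universe el\<close> base fib inv
      \<open>is_induced_topology el I' JI' (base S) (base_top S) \<phi>\<close> dense
    by unfold_locales
  show ?thesis
    unfolding S'_def
    by (rule coevanescent_induced) (use assms(8,12) in \<open>simp_all add: S'_def\<close>)
qed

end
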